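(* Let $n\ge3$ and $1\le p<q<\infty$. Then for each restricted region $B$ of the Lorentz cone $\Lambda_n$ with vertex at the origin $O$, there exists a constant $C_{p,q}(B)>0$ such that $$\int_{T_B}|F(x+iy)|^q\,\Delta^{\frac n2\left(\frac qp-2\right)}(y)\,dx\,dy\le C_{p,q}(B)\,\|F\|_{H^p}^q$$ for all $F\in H^p(T_{\Lambda_n})$.
   Context: For $n\ge3$, $\Lambda_n=\{y=(y_1,\dots,y_n)\in\mathbb R^n: y_1^2-y_2^2-\cdots-y_n^2>0,\ y_1>0\}$ is the Lorentz cone, with determinant function $\Delta(y)=y_1^2-y_2^2-\cdots-y_n^2$. $T_{\Lambda_n}=\mathbb R^n+i\Lambda_n\subset\mathbb C^n$. A (measurable) subset $B\subset\Lambda_n$ is a restricted region with vertex at the origin $O$ if there is a constant $K>0$ such that for every $y\in B$ the Euclidean distance from $y$ to $O$ is less than $K$ times the Euclidean distance from $y$ to the boundary $\partial\Lambda_n$. $T_B=\mathbb R^n+iB$. $H^p(T_{\Lambda_n})$ is the space of holomorphic $F$ on $T_{\Lambda_n}$ with $\|F\|_{H^p}=\left(\sup_{t\in\Lambda_n}\int_{\mathbb R^n}|F(x+it)|^pdx\right)^{1/p}<\infty$. *)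

theory Defs
  imports "HOL-Analysis.Analysis"
begin

text \<open>
  Real and complex $n$-space are \<open>real ^ 'n\<close> and \<open>complex ^ 'n\<close> with $n = $ \<open>CARD('n)\<close>.
  A finite index type carries no canonical first index, so the distinguished (time-like)
  coordinate, written $y_1$ in the literature, is an explicit parameter \<open>e :: 'n\<close>.
\<close>

definition lorentz_det :: "'n::finite \<Rightarrow> real ^ 'n \<Rightarrow> real" where
  "lorentz_det e y = (y $ e)\<^sup>2 - (\<Sum>j\<in>UNIV - {e}. (y $ j)\<^sup>2)"

definition lorentz_cone :: "'n::finite \<Rightarrow> (real ^ 'n) set" where
  "lorentz_cone e = {y. lorentz_det e y > 0 \<and> y $ e > 0}"

definition complex_vec :: "real ^ 'n::finite \<Rightarrow> real ^ 'n \<Rightarrow> complex ^ 'n" where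
  "complex_vec x y = (\<chi> j. Complex (x $ j) (y $ j))"

definition tube :: "(real ^ 'n::finite) set \<Rightarrow> (complex ^ 'n) set" where
  "tube B = {complex_vec x y | x y. y \<in> B}"

definition restricted_region :: "'n::finite \<Rightarrow> (real ^ 'n) set \<Rightarrow> bool" where
  "restricted_region e B \<longleftrightarrow>
     B \<in> sets lebesgue \<and> B \<subseteq> lorentz_cone e \<and>
     (\<exists>K>0. \<forall>y\<in>B. dist y 0 < K * infdist y (frontier (lorentz_cone e)))"

text \<open>
  The library's \<open>holomorphic_on\<close> covers one complex variable only.  In several variables:
  real Frechet differentiability with a complex-linear derivative.
\<close>

definition holomorphic_vec_on :: "(complex ^ 'n::finite \<Rightarrow> complex) \<Rightarrow> (complex ^ 'n) set \<Rightarrow> bool" where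
  "holomorphic_vec_on F S \<longleftrightarrow>
     (\<forall>z\<in>S. \<exists>L. (F has_derivative L) (at z within S) \<and> (\<forall>c v. L (c *s v) = c * L v))"

text \<open>
  The supremum of the integrals is taken in the extended nonnegative reals, so it may be
  infinite; \<open>hardy_norm\<close> is meaningful only when it is finite, which membership in
  \<open>hardy_space\<close> guarantees.
\<close>

definition hardy_sup :: "'n::finite \<Rightarrow> real \<Rightarrow> (complex ^ 'n \<Rightarrow> complex) \<Rightarrow> ennreal" where
  "hardy_sup e p F =
     (SUP t\<in>lorentz_cone e. \<integral>\<^sup>+x. ennreal (cmod (F (complex_vec x t)) powr p) \<partial>lebesgue)"

definition hardy_norm :: "'n::finite \<Rightarrow> real \<Rightarrow> (complex ^ 'n \<Rightarrow> complex) \<Rightarrow> real" where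
  "hardy_norm e p F = enn2real (hardy_sup e p F) powr (1 / p)"

definition hardy_space :: "'n::finite \<Rightarrow> real \<Rightarrow> (complex ^ 'n \<Rightarrow> complex) set" where
  "hardy_space e p =
     {F. holomorphic_vec_on F (tube (lorentz_cone e)) \<and> hardy_sup e p F < \<infinity>}"

end

theory Submission
  imports Defs "HOL-Probability.Sinc_Integral" "HOL-Complex_Analysis.Conformal_Mappings"
begin

text \<open>
  Write \<open>n\<close> for the dimension and \<open>\<kappa> = q / p > 1\<close>.  On a restricted region the quantities
  \<open>norm y\<close>, the distance of \<open>y\<close> to the boundary of the cone, and the square root of \<open>lorentz_det e y\<close>
  are comparable, so the weight is comparable to \<open>(norm y ^ n) powr (\<kappa> - 2)\<close>.  Averaging
  \<open>|F|^p\<close> over a ball of radius comparable to \<open>norm y\<close> gives the decay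
  \<open>|F(x + iy)|^p \<le> A / norm y ^ n\<close> (\<open>pointwise_bound\<close>), with \<open>A\<close> a multiple of the \<open>p\<close>-th power of the
  norm.  This bound alone just fails: it leaves the integral of \<open>norm y powr (-n)\<close>, which diverges
  logarithmically at the vertex and at infinity.

  What rescues the estimate near the vertex is a bound that is uniform in the height,
  \<open>|F(x + iy)|^(p/2) \<le> D * M f x\<close>, where \<open>f\<close> is \<open>|F|^(p/2)\<close> on the real space and \<open>M\<close> is the
  Hardy-Littlewood maximal function (\<open>power_le_maximal\<close>).  For fixed \<open>x\<close> the smaller of the two
  bounds integrates over \<open>y\<close> to a multiple of \<open>A powr (\<kappa> - 1) * (M f x)\<^sup>2\<close> (\<open>radial_integral_le\<close>),
  and integrating over \<open>x\<close> uses that \<open>M\<close> is bounded on \<open>L\<^sup>2\<close> (\<open>maximal_function_L2\<close>) and that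
  \<open>f\<^sup>2 = |F|^p\<close>.  The exponent \<open>p/2\<close> is chosen so that the maximal function acts on \<open>L\<^sup>2\<close> whatever
  \<open>p\<close> is; in particular the endpoint \<open>p = 1\<close>, where the maximal function is not bounded
  on \<open>L\<^sup>p\<close>, is covered.

  This choice requires mean value inequalities for \<open>|F|^s\<close> with small \<open>s > 0\<close>.  They all come from one
  inequality on the disc (\<open>power_submean_disc\<close>).  Applied on complex discs it yields the mean value
  inequality over balls of the complex space (\<open>power_submean_ball\<close>); applied through a Cayley transform
  on complex half-planes it yields a Poisson-type inequality along a real line
  (\<open>power_submean_tube\<close>), which leads from height \<open>y\<close> down to height \<open>0\<close>.  The two together dominate
  \<open>|F(x + iy)|^s\<close> by the average over \<open>x'\<close> near \<open>x\<close>, \<open>y'\<close> near \<open>y\<close> and \<open>t\<close> (Cauchy distributed) of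
  \<open>f(x' + t y')\<close>.  For every \<open>t\<close> this average is at most a multiple of \<open>M f x\<close>: the average in \<open>x'\<close>
  smooths at the right scale if \<open>|t| \<le> 1\<close>, the one in \<open>y'\<close> if \<open>|t| \<ge> 1\<close> (\<open>average_le_maximal\<close>).

  Boundary values of \<open>F\<close> are avoided.  The argument is applied to \<open>F\<close> shifted upwards by \<open>\<epsilon>\<close> times
  the axis of the cone; the shifted function is bounded and continuous up to the real space, the
  constants are independent of \<open>\<epsilon>\<close> (\<open>core_integral_le\<close>), and Fatou's lemma lets \<open>\<epsilon>\<close> tend to \<open>0\<close>.
\<close>

section \<open>A mean value inequality for powers of holomorphic functions on the disc\<close>

text \<open>
  The restrictions to the unit circle of real parts of polynomials.  They are the trigonometric
  polynomials, hence an algebra, and each has an explicit harmonic extension to the disc.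
\<close>

definition circle_real_part :: "(complex \<Rightarrow> real) \<Rightarrow> bool" where
  "circle_real_part f \<longleftrightarrow> (\<exists>P. \<forall>w\<in>sphere 0 1. f w = Re (poly P w))"

lemma circle_real_part_cong:
  assumes "circle_real_part f" "\<And>w. cmod w = 1 \<Longrightarrow> g w = f w"
  shows "circle_real_part g"
  using assms unfolding circle_real_part_def by auto

lemma circle_real_part_add:
  assumes "circle_real_part f" "circle_real_part g"
  shows "circle_real_part (\<lambda>w. f w + g w)"
proof -
  obtain P Q where "\<forall>w\<in>sphere 0 1. f w = Re (poly P w)" "\<forall>w\<in>sphere 0 1. g w = Re (poly Q w)"
    using assms unfolding circle_real_part_def by blast
  then show ?thesis
    unfolding circle_real_part_def by (intro exI[of _ "P + Q"]) auto
qed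

lemma circle_real_part_const: "circle_real_part (\<lambda>w. c)"
  unfolding circle_real_part_def by (intro exI[of _ "[:of_real c:]"]) auto

lemma circle_real_part_sum:
  "(\<And>i. i \<in> I \<Longrightarrow> circle_real_part (f i)) \<Longrightarrow> circle_real_part (\<lambda>w. \<Sum>i\<in>I. f i w)"
  by (induction I rule: infinite_finite_induct)
     (auto intro: circle_real_part_const circle_real_part_add)

lemma Re_times_Re: "Re u * Re v = (Re (u * v) + Re (u * cnj v)) / 2"
  by (simp add: field_simps)

text \<open>
  On the unit circle \<open>cnj w = 1 / w\<close>, so the mixed term in \<open>Re_times_Re\<close> is again a power of \<open>w\<close>, up to
  conjugation.  It is a nonnegative power when the factor of higher degree comes first.
\<close>

lemma circle_real_part_monom_mult:
  "circle_real_part (\<lambda>w. Re (a * w ^ i) * Re (b * w ^ j))"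
proof -
  have *: "circle_real_part (\<lambda>w. Re (a * w ^ i) * Re (b * w ^ j))" if "j \<le> i" for a b i j
  proof -
    have "Re (a * w ^ i) * Re (b * w ^ j)
        = Re (poly (monom (a * b / 2) (i + j) + monom (a * cnj b / 2) (i - j)) w)"
      if w: "cmod w = 1" for w
    proof -
      have "w ^ i * cnj w ^ j = w ^ (i - j) * (w * cnj w) ^ j"
        using \<open>j \<le> i\<close> by (simp add: power_mult_distrib mult.assoc[symmetric] flip: power_add)
      moreover have "w * cnj w = 1"
        using w by (simp add: complex_norm_square[symmetric])
      ultimately have c: "w ^ i * cnj w ^ j = w ^ (i - j)"
        by simp
      have "Re (a * w ^ i) * Re (b * w ^ j)
          = (Re (a * b * w ^ (i + j)) + Re (a * cnj b * (w ^ i * cnj w ^ j))) / 2"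
        unfolding Re_times_Re by (simp only: complex_cnj_mult complex_cnj_power power_add mult_ac)
      also have "\<dots> = Re (a * b * w ^ (i + j) / 2 + a * cnj b * w ^ (i - j) / 2)"
        unfolding c by (simp only: add_divide_distrib Re_divide_numeral plus_complex.sel)
      finally show ?thesis by (simp add: poly_monom)
    qed
    then show ?thesis
      unfolding circle_real_part_def
      by (intro exI[of _ "monom (a * b / 2) (i + j) + monom (a * cnj b / 2) (i - j)"] ballI)
         (simp only: mem_sphere_0)
  qed
  show ?thesis
  proof (cases "j \<le> i")
    case True then show ?thesis by (rule *)
  next
    case False
    then have "circle_real_part (\<lambda>w. Re (b * w ^ j) * Re (a * w ^ i))" by (intro *) auto
    then show ?thesis by (rule circle_real_part_cong) (simp add: mult.commute)
  qed
qed

lemma circle_real_part_mult: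
  assumes "circle_real_part f" "circle_real_part g"
  shows "circle_real_part (\<lambda>w. f w * g w)"
proof -
  obtain P Q where P: "\<forall>w\<in>sphere 0 1. f w = Re (poly P w)" and Q: "\<forall>w\<in>sphere 0 1. g w = Re (poly Q w)"
    using assms unfolding circle_real_part_def by blast
  have "circle_real_part (\<lambda>w. \<Sum>i\<le>degree P. \<Sum>j\<le>degree Q. Re (coeff P i * w ^ i) * Re (coeff Q j * w ^ j))"
    by (intro circle_real_part_sum circle_real_part_monom_mult)
  then show ?thesis
    by (rule circle_real_part_cong) (use P Q in \<open>auto simp: poly_altdef sum_product\<close>)
qed

lemma circle_approx_real_part_poly:
  fixes \<phi> :: "complex \<Rightarrow> real"
  assumes "continuous_on (sphere 0 1) \<phi>" "0 < \<epsilon>"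
  obtains P where "\<And>w. cmod w = 1 \<Longrightarrow> \<bar>\<phi> w - Re (poly P w)\<bar> < \<epsilon>"
proof -
  interpret function_ring_on "Collect circle_real_part" "sphere 0 1"
  proof
    fix f assume "f \<in> Collect circle_real_part"
    then obtain P where P: "\<forall>w\<in>sphere 0 1. f w = Re (poly P w)"
      by (auto simp: circle_real_part_def)
    have "continuous_on (sphere 0 1) (\<lambda>w. Re (poly P w))"
      by (intro continuous_intros)
    then show "continuous_on (sphere 0 1) f"
      using P by (subst continuous_on_cong) auto
  next
    fix x y :: complex assume "x \<noteq> y"
    have "circle_real_part Re" "circle_real_part Im"
      unfolding circle_real_part_def
      by (rule exI[of _ "[:0, 1:]"], simp) (rule exI[of _ "[:0, - \<i>:]"], simp)
    then show "\<exists>f\<in>Collect circle_real_part. f x \<noteq> f y"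
      using \<open>x \<noteq> y\<close> by (auto simp: complex_eq_iff)
  qed (auto intro: circle_real_part_const circle_real_part_add circle_real_part_mult)
  obtain g where g: "circle_real_part g" "\<forall>x\<in>sphere 0 1. \<bar>\<phi> x - g x\<bar> < \<epsilon>"
    using Stone_Weierstrass_basic[OF assms] by blast
  then obtain P where "\<forall>w\<in>sphere 0 1. g w = Re (poly P w)"
    unfolding circle_real_part_def by blast
  with g show ?thesis by (intro that[of P]) auto
qed

text \<open>
  The Poisson kernel of the upper half-plane at the point \<open>\<i>\<close>.  The map \<open>cayley\<close> below carries this
  measure on the real line to the normalized arc length on the unit circle, which is the source of the mean
  value property \<open>integral_poly_cayley\<close>.  Parametrizing the circle by the line serves discs and
  half-planes alike.
\<close>

definition cauchy_measure :: "real measure" where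
  "cauchy_measure = density lborel (\<lambda>t. ennreal (1 / (pi * (1 + t\<^sup>2))))"

definition cayley :: "real \<Rightarrow> complex" where
  "cayley t = (of_real t - \<i>) / (of_real t + \<i>)"

lemma real_plus_i_nonzero: "complex_of_real t + \<i> \<noteq> 0" "1 + t\<^sup>2 \<noteq> (0::real)"
  by (auto simp: complex_eq_iff add_nonneg_eq_0_iff)

lemma cmod_cayley [simp]: "cmod (cayley t) = 1"
proof -
  have "cmod (of_real t - \<i>) = cmod (of_real t + \<i>)"
    by (simp add: cmod_def)
  moreover have "cmod (of_real t + \<i>) \<noteq> 0"
    using real_plus_i_nonzero by simp
  ultimately show ?thesis
    unfolding cayley_def norm_divide by simp
qed

lemma continuous_on_cayley: "continuous_on A cayley"
  unfolding cayley_def by (intro continuous_intros) (auto simp: real_plus_i_nonzero)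

lemma cayley_measurable [measurable]: "cayley \<in> borel_measurable borel"
  by (intro borel_measurable_continuous_onI continuous_on_cayley)

lemma sets_cauchy_measure [measurable_cong, simp]: "sets cauchy_measure = sets borel"
  and space_cauchy_measure [simp]: "space cauchy_measure = UNIV"
  by (auto simp: cauchy_measure_def)

lemma integrable_cauchy_density: "integrable lborel (\<lambda>t::real. 1 / (1 + t\<^sup>2))"
  using integrable_inverse_1_plus_square
  by (simp add: set_integrable_def einterval_def inverse_eq_divide)

lemma integral_cauchy_density: "integral\<^sup>L lborel (\<lambda>t::real. 1 / (1 + t\<^sup>2)) = pi"
  using LBINT_inverse_1_plus_square
  by (simp add: interval_lebesgue_integral_def set_lebesgue_integral_def einterval_def inverse_eq_divide)

lemma emeasure_cauchy_measure: "emeasure cauchy_measure UNIV = 1"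
proof -
  have "emeasure cauchy_measure UNIV = (\<integral>\<^sup>+t. ennreal (1 / (pi * (1 + t\<^sup>2))) \<partial>lborel)"
    unfolding cauchy_measure_def by (subst emeasure_density) auto
  also have "\<dots> = ennreal (integral\<^sup>L lborel (\<lambda>t::real. (1 / pi) * (1 / (1 + t\<^sup>2))))"
    using integrable_mult_right[OF integrable_cauchy_density, of "1 / pi"]
    by (subst nn_integral_eq_integral[symmetric]) auto
  also have "\<dots> = 1"
    using integral_cauchy_density by (simp only: integral_mult_right_zero) simp
  finally show ?thesis .
qed

interpretation cauchy_measure: prob_space cauchy_measure
  by standard (simp add: emeasure_cauchy_measure)

lemma integrable_cauchy_measure_bounded:
  fixes f :: "real \<Rightarrow> 'b::{banach, second_countable_topology}"
  assumes "f \<in> borel_measurable borel" "\<And>t. norm (f t) \<le> B"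
  shows "integrable cauchy_measure f"
  by (rule cauchy_measure.integrable_const_bound[of _ B]) (use assms in auto)

lemma cayley_has_vector_derivative:
  "(cayley has_vector_derivative 2 * \<i> * cayley t / (1 + t\<^sup>2)) (at t)"
proof -
  have "((\<lambda>z. (z - \<i>) / (z + \<i>)) has_field_derivative 2 * \<i> / (of_real t + \<i>)\<^sup>2) (at (of_real t))"
    using real_plus_i_nonzero(1)[of t]
    by (auto intro!: derivative_eq_intros simp: field_simps power2_eq_square)
  then have "((\<lambda>z. (z - \<i>) / (z + \<i>)) \<circ> of_real has_vector_derivative 1 * (2 * \<i> / (of_real t + \<i>)\<^sup>2)) (at t)"
    by (intro field_vector_diff_chain_at) (auto intro: derivative_eq_intros simp: has_vector_derivative_of_real)
  moreover have "2 * \<i> / (of_real t + \<i>)\<^sup>2 = 2 * \<i> * cayley t / (1 + t\<^sup>2)"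
  proof -
    have e: "1 + (of_real t)\<^sup>2 = (of_real t + \<i>) * (of_real t - \<i>)"
      by (simp add: algebra_simps power2_eq_square)
    have "complex_of_real t - \<i> \<noteq> 0" by (auto simp: complex_eq_iff)
    moreover have "2 * \<i> / u\<^sup>2 = 2 * \<i> * (v / u) / (u * v)" if "u \<noteq> 0" "v \<noteq> 0" for u v :: complex
      using that by (simp add: field_simps power2_eq_square)
    ultimately show ?thesis
      unfolding cayley_def of_real_add of_real_power of_real_1 e
      using real_plus_i_nonzero(1)[of t] by blast
  qed
  moreover have "(\<lambda>z. (z - \<i>) / (z + \<i>)) \<circ> of_real = cayley"
    by (simp add: cayley_def o_def fun_eq_iff)
  ultimately show ?thesis by simp
qed

text \<open>
  The integrand \<open>cayley t ^ k / (1 + t\<^sup>2)\<close> is the derivative of \<open>cayley t ^ k / (2 * \<i> * k)\<close>, which has the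
  same limit at both ends of the line.
\<close>

lemma integral_cayley_power:
  assumes "k > 0"
  shows "integral\<^sup>L cauchy_measure (\<lambda>t. cayley t ^ k) = 0"
proof -
  have lim: "(cayley \<longlongrightarrow> 1) at_top" "(cayley \<longlongrightarrow> 1) at_bot"
  proof -
    have inf: "filterlim (\<lambda>t. complex_of_real t + \<i>) at_infinity F" if "filterlim (\<lambda>t::real. t) at_infinity F" for F
    proof -
      have "filterlim (\<lambda>t. norm (complex_of_real t + \<i>)) at_top F"
      proof (rule filterlim_at_top_mono)
        show "filterlim (\<lambda>t::real. norm t) at_top F"
          using that by (simp add: filterlim_at_infinity_conv_norm_at_top)
        show "eventually (\<lambda>t. norm t \<le> norm (complex_of_real t + \<i>)) F"
        proof (rule always_eventually, rule allI)
          fix t :: real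
          show "norm t \<le> norm (complex_of_real t + \<i>)"
            using abs_Re_le_cmod[of "complex_of_real t + \<i>"] by simp
        qed
      qed
      then show ?thesis by (simp add: filterlim_at_infinity_conv_norm_at_top)
    qed
    have eq: "cayley = (\<lambda>t. 1 - 2 * \<i> / (of_real t + \<i>))"
    proof
      fix t show "cayley t = 1 - 2 * \<i> / (of_real t + \<i>)"
        using real_plus_i_nonzero(1)[of t] by (simp add: cayley_def field_simps)
    qed
    have "(cayley \<longlongrightarrow> 1 - 0) F" if "filterlim (\<lambda>t::real. t) at_infinity F" for F
      unfolding eq by (intro tendsto_diff tendsto_const tendsto_divide_0[OF tendsto_const] inf that)
    then show "(cayley \<longlongrightarrow> 1) at_top" "(cayley \<longlongrightarrow> 1) at_bot"
      using filterlim_at_top_imp_at_infinity[of "\<lambda>t::real. t"] filterlim_at_bot_imp_at_infinity[of "\<lambda>t::real. t"]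
      by (auto simp: filterlim_ident)
  qed
  define g where "g t = cayley t ^ k / (1 + t\<^sup>2)" for t
  have int: "integrable lborel g"
  proof (rule Bochner_Integration.integrable_bound[OF integrable_cauchy_density])
    show "g \<in> borel_measurable lborel" unfolding g_def by measurable
    have "cmod (1 + (complex_of_real t)\<^sup>2) = 1 + t\<^sup>2" for t
    proof -
      have "1 + (complex_of_real t)\<^sup>2 = complex_of_real (1 + t\<^sup>2)" by simp
      then show ?thesis by (simp only: norm_of_real)  simp
    qed
    then show "AE t in lborel. norm (g t) \<le> norm (1 / (1 + t\<^sup>2))"
      by (auto simp: g_def norm_divide norm_power)
  qed
  have "(LBINT t=-\<infinity>..\<infinity>. g t) = 1 ^ k / (2 * \<i> * k) - 1 ^ k / (2 * \<i> * k)"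
  proof (rule interval_integral_FTC_integrable[where F = "\<lambda>t. cayley t ^ k / (2 * \<i> * k)"])
    fix t :: real
    obtain m where k: "k = Suc m" using assms by (cases k) auto
    have "((\<lambda>z. z ^ k / (2 * \<i> * k)) \<circ> cayley has_vector_derivative
        (2 * \<i> * cayley t / (1 + t\<^sup>2)) * (of_nat k * cayley t ^ m / (2 * \<i> * k))) (at t)"
      by (rule field_vector_diff_chain_at[OF cayley_has_vector_derivative])
         (rule DERIV_cong[OF DERIV_cdivide[OF DERIV_power[OF DERIV_ident]]], simp add: k del: of_nat_Suc)
    moreover have "(2 * \<i> * cayley t / (1 + t\<^sup>2)) * (of_nat k * cayley t ^ m / (2 * \<i> * k)) = g t"
    proof -
      have *: "2 * \<i> * a / b * (N * x / (2 * \<i> * N)) = a * x / b" if "N \<noteq> 0" for a b x N :: complex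
        using that by (cases "b = 0") (auto simp: field_simps)
      have "of_nat k \<noteq> (0 :: complex)" using assms by simp
      from *[OF this] show ?thesis
        unfolding g_def by (simp only: k power_Suc)
    qed
    ultimately show "((\<lambda>t. cayley t ^ k / (2 * \<i> * k)) has_vector_derivative g t) (at t)"
      by (simp add: o_def)
    show "isCont g t"
      unfolding g_def
      using continuous_on_cayley[of UNIV] real_plus_i_nonzero(2)[of t]
      by (intro continuous_intros) (auto simp: continuous_on_eq_continuous_at simp flip: of_real_power of_real_add)
    have "((\<lambda>t. cayley t ^ k / (2 * \<i> * k)) \<longlongrightarrow> 1 ^ k / (2 * \<i> * k)) at_top"
         "((\<lambda>t. cayley t ^ k / (2 * \<i> * k)) \<longlongrightarrow> 1 ^ k / (2 * \<i> * k)) at_bot"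
      using assms lim by (auto intro!: tendsto_divide tendsto_power simp del: power_one)
    then show "(((\<lambda>t. cayley t ^ k / (2 * \<i> * k)) \<circ> real_of_ereal) \<longlongrightarrow> 1 ^ k / (2 * \<i> * k)) (at_right (-\<infinity>))"
         "(((\<lambda>t. cayley t ^ k / (2 * \<i> * k)) \<circ> real_of_ereal) \<longlongrightarrow> 1 ^ k / (2 * \<i> * k)) (at_left \<infinity>)"
      by (simp_all only: ereal_tendsto_simps)
  qed (use int in \<open>auto simp: set_integrable_def einterval_def\<close>)
  then have "integral\<^sup>L lborel g = 0"
    by (simp add: interval_lebesgue_integral_def set_lebesgue_integral_def einterval_def)
  moreover have "integral\<^sup>L cauchy_measure (\<lambda>t. cayley t ^ k)
      = integral\<^sup>L lborel (\<lambda>t. (1 / (pi * (1 + t\<^sup>2))) *\<^sub>R cayley t ^ k)"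
    unfolding cauchy_measure_def by (subst integral_density) auto
  moreover have "(\<lambda>t. (1 / (pi * (1 + t\<^sup>2))) *\<^sub>R cayley t ^ k) = (\<lambda>t. complex_of_real (1 / pi) * g t)"
    unfolding g_def by (auto simp: scaleR_conv_of_real fun_eq_iff)
  ultimately show ?thesis by simp
qed


lemma integral_poly_cayley:
  "integral\<^sup>L cauchy_measure (\<lambda>t. Re (poly P (cayley t))) = Re (poly P 0)"
proof -
  have int: "integrable cauchy_measure (\<lambda>t. cayley t ^ i)" for i
    by (rule integrable_cauchy_measure_bounded[of _ 1]) (auto simp: norm_power)
  have "integral\<^sup>L cauchy_measure (\<lambda>t. poly P (cayley t))
      = (\<Sum>i\<le>degree P. coeff P i * integral\<^sup>L cauchy_measure (\<lambda>t. cayley t ^ i))"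
    unfolding poly_altdef using int
    by (subst Bochner_Integration.integral_sum) auto
  also have "\<dots> = (\<Sum>i\<le>degree P. if i = 0 then coeff P i else 0)"
    by (intro sum.cong) (auto simp: integral_cayley_power cauchy_measure.prob_space[simplified])
  also have "\<dots> = poly P 0"
    by (simp add: poly_0_coeff_0)
  finally show ?thesis
    using int by (subst integral_Re) (auto simp: poly_altdef)
qed

text \<open>
  The inequality for \<open>|f|^s\<close> without any discussion of the zeros of \<open>f\<close>.  The function
  \<open>ln (|f| + \<delta>)\<close> is continuous on the circle, so it lies between \<open>Re P - 2\<epsilon>\<close> and \<open>Re P\<close> for a polynomial
  \<open>P\<close>.  The maximum principle for \<open>f * exp (- P)\<close> turns this into \<open>|f 0| \<le> exp (Re (P 0))\<close>; as
  \<open>Re (P 0)\<close> is the mean of \<open>Re P\<close>, Jensen's inequality for the exponential function finishes.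
\<close>

lemma power_submean_disc_aux:
  assumes contf: "continuous_on (cball 0 1) f" and holf: "f holomorphic_on ball 0 1"
    and pos: "0 < s" "0 < \<delta>" "0 < \<epsilon>"
  shows "cmod (f 0) powr s
      \<le> exp (2 * s * \<epsilon>) * (\<integral>t. (cmod (f (cayley t)) + \<delta>) powr s \<partial>cauchy_measure)"
proof -
  have conts: "continuous_on (sphere 0 1) f"
    by (rule continuous_on_subset[OF contf]) auto
  have posd: "0 < cmod (f w) + \<delta>" for w
    using pos norm_ge_zero[of "f w"] by linarith
  have "continuous_on (sphere 0 1) (\<lambda>w. ln (cmod (f w) + \<delta>) + \<epsilon>)"
    by (intro continuous_intros conts) (metis posd less_irrefl)
  from circle_approx_real_part_poly[OF this \<open>0 < \<epsilon>\<close>]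
  obtain P where P: "\<And>w. cmod w = 1 \<Longrightarrow> \<bar>ln (cmod (f w) + \<delta>) + \<epsilon> - Re (poly P w)\<bar> < \<epsilon>"
    by blast
  have lower: "cmod (f w) \<le> exp (Re (poly P w))" if "cmod w = 1" for w
  proof -
    have "cmod (f w) \<le> exp (ln (cmod (f w) + \<delta>))" using posd[of w] pos by simp
    also have "\<dots> \<le> exp (Re (poly P w))"
      using P[OF that] by (subst exp_le_cancel_iff) linarith
    finally show ?thesis .
  qed
  have upper: "exp (s * Re (poly P w)) \<le> exp (2 * s * \<epsilon>) * (cmod (f w) + \<delta>) powr s" if "cmod w = 1" for w
  proof -
    have "s * Re (poly P w) \<le> s * (2 * \<epsilon> + ln (cmod (f w) + \<delta>))"
      using P[OF that] pos by (intro mult_left_mono) auto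
    then have "exp (s * Re (poly P w)) \<le> exp (2 * s * \<epsilon> + s * ln (cmod (f w) + \<delta>))"
      by (simp add: algebra_simps)
    also have "\<dots> = exp (2 * s * \<epsilon>) * (cmod (f w) + \<delta>) powr s"
      using posd[of w] by (simp add: exp_add powr_def)
    finally show ?thesis .
  qed
  have "norm (f 0 * exp (- poly P 0)) \<le> 1"
  proof (rule maximum_modulus_frontier[of "\<lambda>w. f w * exp (- poly P w)" "ball 0 1"])
    show "(\<lambda>w. f w * exp (- poly P w)) holomorphic_on interior (ball 0 1)"
      by (auto intro!: holomorphic_intros holf)
    show "continuous_on (closure (ball 0 1)) (\<lambda>w. f w * exp (- poly P w))"
      by (auto intro!: continuous_intros contf)
    fix z :: complex assume "z \<in> frontier (ball 0 1)"
    then have "cmod z = 1" by simp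
    then show "norm (f z * exp (- poly P z)) \<le> 1"
      using lower[of z] by (simp add: norm_mult exp_minus field_simps norm_divide)
  qed auto
  then have f0: "cmod (f 0) \<le> exp (Re (poly P 0))"
    by (simp add: norm_mult exp_minus field_simps norm_divide)
  define m where "m = s * Re (poly P 0)"
  obtain K where K: "\<And>w. w \<in> sphere 0 1 \<Longrightarrow> cmod (f w) \<le> K"
    using compact_imp_bounded[OF compact_continuous_image[OF conts compact_sphere]]
    unfolding bounded_iff by blast
  have meas: "(\<lambda>t. cmod (f (cayley t))) \<in> borel_measurable borel"
    by (intro borel_measurable_continuous_onI continuous_on_norm
          continuous_on_compose2[OF conts continuous_on_cayley]) auto
  have i1: "integrable cauchy_measure (\<lambda>t. Re (poly P (cayley t)))"
  proof -
    have "bounded (poly P ` sphere 0 1)"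
      by (intro compact_imp_bounded compact_continuous_image continuous_intros) auto
    then obtain L where L: "\<And>w. w \<in> sphere 0 1 \<Longrightarrow> cmod (poly P w) \<le> L"
      unfolding bounded_iff by blast
    show ?thesis
    proof (rule integrable_cauchy_measure_bounded[of _ L])
      show "(\<lambda>t. Re (poly P (cayley t))) \<in> borel_measurable borel"
        by (intro borel_measurable_continuous_onI continuous_intros continuous_on_cayley)
      show "norm (Re (poly P (cayley t))) \<le> L" for t
        using L[of "cayley t"] abs_Re_le_cmod[of "poly P (cayley t)"] by simp
    qed
  qed
  have i2: "integrable cauchy_measure (\<lambda>t. (cmod (f (cayley t)) + \<delta>) powr s)"
  proof (rule integrable_cauchy_measure_bounded[of _ "(K + \<delta>) powr s"])
    show "(\<lambda>t. (cmod (f (cayley t)) + \<delta>) powr s) \<in> borel_measurable borel"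
      using meas by measurable
    show "norm ((cmod (f (cayley t)) + \<delta>) powr s) \<le> (K + \<delta>) powr s" for t
      using K[of "cayley t"] pos by (auto intro!: powr_mono2)
  qed
  \<comment> \<open>Jensen's inequality for \<open>exp\<close>, via the tangent line at the mean\<close>
  have "exp m * (1 + s * (Re (poly P (cayley t))) - m) \<le> exp (2 * s * \<epsilon>) * (cmod (f (cayley t)) + \<delta>) powr s" for t
  proof -
    have "exp m * (1 + (s * Re (poly P (cayley t)) - m)) \<le> exp m * exp (s * Re (poly P (cayley t)) - m)"
      by (intro mult_left_mono exp_ge_add_one_self) auto
    also have "\<dots> = exp (s * Re (poly P (cayley t)))"
      by (simp flip: exp_add)
    also have "\<dots> \<le> exp (2 * s * \<epsilon>) * (cmod (f (cayley t)) + \<delta>) powr s"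
      by (rule upper) simp
    finally show ?thesis by (simp add: algebra_simps)
  qed
  then have "(\<integral>t. exp m * (1 + s * (Re (poly P (cayley t))) - m) \<partial>cauchy_measure)
      \<le> (\<integral>t. exp (2 * s * \<epsilon>) * (cmod (f (cayley t)) + \<delta>) powr s \<partial>cauchy_measure)"
    by (intro integral_mono) (use i1 i2 in auto)
  moreover have "(\<integral>t. exp m * (1 + s * (Re (poly P (cayley t))) - m) \<partial>cauchy_measure) = exp m"
    using i1 cauchy_measure.prob_space by (simp add: integral_poly_cayley m_def)
  ultimately have "exp m \<le> exp (2 * s * \<epsilon>) * (\<integral>t. (cmod (f (cayley t)) + \<delta>) powr s \<partial>cauchy_measure)"
    by simp
  moreover have "cmod (f 0) powr s \<le> exp m"
  proof -
    have "cmod (f 0) powr s \<le> exp (Re (poly P 0)) powr s"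
      using f0 pos by (intro powr_mono2) auto
    then show ?thesis by (simp add: m_def powr_def)
  qed
  ultimately show ?thesis by linarith
qed

lemma power_submean_disc:
  assumes contf: "continuous_on (cball 0 1) f" and holf: "f holomorphic_on ball 0 1" and s: "0 < s"
  shows "ennreal (cmod (f 0) powr s) \<le> (\<integral>\<^sup>+t. ennreal (cmod (f (cayley t)) powr s) \<partial>cauchy_measure)"
proof -
  have conts: "continuous_on (sphere 0 1) f"
    by (rule continuous_on_subset[OF contf]) auto
  obtain K where K: "\<And>w. w \<in> sphere 0 1 \<Longrightarrow> cmod (f w) \<le> K"
    using compact_imp_bounded[OF compact_continuous_image[OF conts compact_sphere]]
    unfolding bounded_iff by blast
  have meas [measurable]: "(\<lambda>t. cmod (f (cayley t))) \<in> borel_measurable borel"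
    by (intro borel_measurable_continuous_onI continuous_on_norm
          continuous_on_compose2[OF conts continuous_on_cayley]) auto
  let ?d = "\<lambda>k. inverse (real (Suc k))"
  have "(\<lambda>k. \<integral>t. (cmod (f (cayley t)) + ?d k) powr s \<partial>cauchy_measure)
      \<longlonglongrightarrow> (\<integral>t. cmod (f (cayley t)) powr s \<partial>cauchy_measure)"
  proof (rule integral_dominated_convergence[where w = "\<lambda>t. (K + 1) powr s"])
    show "AE t in cauchy_measure. (\<lambda>k. (cmod (f (cayley t)) + ?d k) powr s) \<longlonglongrightarrow> cmod (f (cayley t)) powr s"
    proof (rule AE_I2)
      fix t
      have "(\<lambda>k. (cmod (f (cayley t)) + ?d k) powr s) \<longlonglongrightarrow> (cmod (f (cayley t)) + 0) powr s"
        using s by (intro tendsto_powr2 tendsto_add tendsto_const LIMSEQ_inverse_real_of_nat)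
            (auto intro!: always_eventually add_nonneg_nonneg)
      then show "(\<lambda>k. (cmod (f (cayley t)) + ?d k) powr s) \<longlonglongrightarrow> cmod (f (cayley t)) powr s" by simp
    qed
    show "AE t in cauchy_measure. norm ((cmod (f (cayley t)) + ?d k) powr s) \<le> (K + 1) powr s" for k
    proof (rule AE_I2)
      fix t
      have "?d k \<le> 1" by (simp add: field_simps)
      then have "cmod (f (cayley t)) + ?d k \<le> K + 1"
        using K[of "cayley t"] by simp
      then show "norm ((cmod (f (cayley t)) + ?d k) powr s) \<le> (K + 1) powr s"
        using s by (auto intro!: powr_mono2 add_nonneg_nonneg)
    qed
  qed auto
  moreover have "(\<lambda>k. exp (2 * s * ?d k)) \<longlonglongrightarrow> exp (2 * s * 0)"
    by (intro tendsto_intros LIMSEQ_inverse_real_of_nat)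
  ultimately have "(\<lambda>k. exp (2 * s * ?d k) * (\<integral>t. (cmod (f (cayley t)) + ?d k) powr s \<partial>cauchy_measure))
      \<longlonglongrightarrow> exp (2 * s * 0) * (\<integral>t. cmod (f (cayley t)) powr s \<partial>cauchy_measure)"
    by (intro tendsto_mult)
  then have "cmod (f 0) powr s \<le> exp (2 * s * 0) * (\<integral>t. cmod (f (cayley t)) powr s \<partial>cauchy_measure)"
    by (rule LIMSEQ_le_const) (use power_submean_disc_aux[OF contf holf s] in auto)
  moreover have "integrable cauchy_measure (\<lambda>t. cmod (f (cayley t)) powr s)"
    by (rule integrable_cauchy_measure_bounded[of _ "K powr s"])
       (use K s in \<open>auto intro!: powr_mono2\<close>)
  ultimately show ?thesis
    by (subst nn_integral_eq_integral) (auto intro!: ennreal_leI)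
qed

section \<open>The Hardy-Littlewood maximal function\<close>

text \<open>
  Restricting to rational radii makes the supremum countable, hence measurable; it costs a factor in
  \<open>nn_integral_ball_le_maximal\<close>, where an arbitrary radius \<open>r\<close> is enlarged to a rational one below \<open>2 * r\<close>.
\<close>

definition maximal_function :: "('a::euclidean_space \<Rightarrow> ennreal) \<Rightarrow> 'a \<Rightarrow> ennreal" where
  "maximal_function f x =
     (SUP r\<in>{r\<in>\<rat>. 0 < r}. (\<integral>\<^sup>+u. f u * indicator (ball x r) u \<partial>lborel) / emeasure lborel (ball x r))"

lemma emeasure_lborel_ball_center:
  "emeasure lborel (ball (x::'a::euclidean_space) r) = emeasure lborel (ball (0::'a) r)"
proof (cases "0 \<le> r")
  case True then show ?thesis by (simp add: emeasure_ball)
next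
  case False then show ?thesis by (simp add: ball_empty)
qed

lemma maximal_function_measurable [measurable]:
  fixes f :: "'a::euclidean_space \<Rightarrow> ennreal"
  assumes [measurable]: "f \<in> borel_measurable borel"
  shows "maximal_function f \<in> borel_measurable borel"
proof -
  have c: "countable {r\<in>\<rat>. 0 < (r::real)}"
    by (rule countable_subset[OF _ countable_rat]) auto
  have "(\<lambda>x. \<integral>\<^sup>+u. f u * indicator (ball x r) u \<partial>lborel) \<in> borel_measurable (borel :: 'a measure)" for r
  proof -
    define S where "S = {p :: 'a \<times> 'a. dist (fst p) (snd p) < r}"
    have [measurable]: "S \<in> sets (borel \<Otimes>\<^sub>M borel)"
      unfolding S_def borel_prod by (intro borel_open open_Collect_less continuous_intros)
    have "(\<lambda>(x, u). f u * indicator S (x, u)) \<in> borel_measurable (borel \<Otimes>\<^sub>M lborel)"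
      by measurable
    then have "(\<lambda>x. \<integral>\<^sup>+u. f u * indicator S (x, u) \<partial>lborel) \<in> borel_measurable borel"
      by (rule lborel.borel_measurable_nn_integral)
    moreover have "indicator S (x, u) = (indicator (ball x r) u :: ennreal)" for x u
      by (simp add: S_def indicator_def)
    ultimately show ?thesis by simp
  qed
  then have "(\<lambda>x. (\<integral>\<^sup>+u. f u * indicator (ball x r) u \<partial>lborel) / emeasure lborel (ball (0::'a) r))
      \<in> borel_measurable (borel :: 'a measure)" for r
    by measurable
  then show ?thesis
    unfolding maximal_function_def
    by (intro borel_measurable_SUP c) (subst emeasure_lborel_ball_center)
qed

lemma emeasure_ball_pos: "0 < r \<Longrightarrow> 0 < emeasure lborel (ball (x::'a::euclidean_space) r)"
  and emeasure_ball_finite: "emeasure lborel (ball (x::'a::euclidean_space) r) < \<infinity>"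
proof -
  show "0 < emeasure lborel (ball x r)" if "0 < r"
    using that by (simp add: emeasure_ball)
  show "emeasure lborel (ball x r) < \<infinity>"
    using emeasure_lborel_ball_finite[of x r] by simp
qed

lemma emeasure_ball_scale:
  assumes "0 \<le> c" "0 \<le> r"
  shows "emeasure lborel (ball (x::'a::euclidean_space) (c * r)) = ennreal (c ^ DIM('a)) * emeasure lborel (ball (y::'a) r)"
  using assms by (simp add: emeasure_ball power_mult_distrib ennreal_mult[symmetric] mult_ac)

lemma nn_integral_ball_le_maximal:
  fixes f :: "'a::euclidean_space \<Rightarrow> ennreal"
  assumes r: "0 < r" and sub: "A \<subseteq> ball x r"
  shows "(\<integral>\<^sup>+u. f u * indicator A u \<partial>lborel) \<le> emeasure lborel (ball x (2 * r)) * maximal_function f x"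
proof -
  obtain q where q: "q \<in> \<rat>" "r < q" "q < 2 * r"
    using Rats_dense_in_real[of r "2 * r"] r by auto
  let ?I = "\<integral>\<^sup>+u. f u * indicator (ball x q) u \<partial>lborel"
  have pos: "0 < emeasure lborel (ball x q)" using q r by (intro emeasure_ball_pos) auto
  have fin: "emeasure lborel (ball x q) < \<infinity>" by (rule emeasure_ball_finite)
  have "(\<integral>\<^sup>+u. f u * indicator A u \<partial>lborel) \<le> ?I"
    using sub q by (intro nn_integral_mono mult_left_mono) (auto simp: indicator_def)
  also have "?I = ?I / emeasure lborel (ball x q) * emeasure lborel (ball x q)"
    using pos fin by (simp add: ennreal_divide_times)
  also have "\<dots> \<le> maximal_function f x * emeasure lborel (ball x (2 * r))"
  proof (rule mult_mono)
    show "?I / emeasure lborel (ball x q) \<le> maximal_function f x"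
      unfolding maximal_function_def using q r by (intro SUP_upper) auto
    show "emeasure lborel (ball x q) \<le> emeasure lborel (ball x (2 * r))"
      using q by (intro emeasure_mono) auto
  qed auto
  finally show ?thesis by (simp add: mult.commute)
qed

text \<open>
  Every point of the superlevel set is the centre of a ball on which the average of \<open>f\<close> exceeds \<open>l\<close>.
  Vitali's covering lemma selects disjoint balls among these whose fivefold enlargements still cover
  the set.
\<close>

lemma maximal_function_weak_type:
  fixes f :: "'a::euclidean_space \<Rightarrow> ennreal"
  assumes [measurable]: "f \<in> borel_measurable borel" and l: "0 < l"
  shows "ennreal l * emeasure lborel {x. maximal_function f x > ennreal l}
      \<le> ennreal (5 ^ DIM('a)) * (\<integral>\<^sup>+u. f u \<partial>lborel)"
proof (cases "(\<integral>\<^sup>+u. f u \<partial>lborel) = \<infinity>")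
  case True
  then show ?thesis by (simp add: ennreal_mult_top)
next
  case False
  define E where "E = {x. maximal_function f x > ennreal l}"
  define N where "N = enn2real (\<integral>\<^sup>+u. f u \<partial>lborel)"
  have N: "(\<integral>\<^sup>+u. f u \<partial>lborel) = ennreal N" "N \<ge> 0"
    using False by (auto simp: N_def less_top)
  have "\<exists>r. 0 < r \<and> ennreal l * emeasure lborel (ball x r) < (\<integral>\<^sup>+u. f u * indicator (ball x r) u \<partial>lborel)"
    if "x \<in> E" for x
  proof -
    from that obtain r where r: "0 < r"
      and "ennreal l < (\<integral>\<^sup>+u. f u * indicator (ball x r) u \<partial>lborel) / emeasure lborel (ball x r)"
      unfolding E_def maximal_function_def by (auto simp: less_SUP_iff)
    then have "ennreal l * emeasure lborel (ball x r) < (\<integral>\<^sup>+u. f u * indicator (ball x r) u \<partial>lborel)"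
      using divide_le_posI_ennreal[OF emeasure_ball_pos[OF r, of x], of _ "ennreal l"]
      by (metis mult.commute not_less)
    with r show ?thesis by blast
  qed
  then obtain \<rho> where \<rho>: "\<And>x. x \<in> E \<Longrightarrow> 0 < \<rho> x"
    "\<And>x. x \<in> E \<Longrightarrow> ennreal l * emeasure lborel (ball x (\<rho> x)) < (\<integral>\<^sup>+u. f u * indicator (ball x (\<rho> x)) u \<partial>lborel)"
    by metis
  define \<omega> where "\<omega> = unit_ball_vol (real DIM('a))"
  have \<omega>: "0 < \<omega>" by (simp add: \<omega>_def)
  have ball: "emeasure lborel (ball (x::'a) r) = ennreal (\<omega> * r ^ DIM('a))" if "0 < r" for x r
    using that by (simp add: emeasure_ball \<omega>_def)
  \<comment> \<open>the radii are bounded because the integral of \<open>f\<close> is finite\<close>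
  define R where "R = max 1 (N / (l * \<omega>))"
  have bdd: "\<rho> x \<le> R" if x: "x \<in> E" for x
  proof -
    have "ennreal (l * (\<omega> * \<rho> x ^ DIM('a))) \<le> ennreal N"
    proof -
      have "ennreal (l * (\<omega> * \<rho> x ^ DIM('a))) = ennreal l * emeasure lborel (ball x (\<rho> x))"
        using l \<omega> \<rho>(1)[OF x] by (simp add: ball ennreal_mult)
      also have "\<dots> \<le> (\<integral>\<^sup>+u. f u * indicator (ball x (\<rho> x)) u \<partial>lborel)"
        using \<rho>(2)[OF x] by simp
      also have "\<dots> \<le> (\<integral>\<^sup>+u. f u \<partial>lborel)"
        by (intro nn_integral_mono) (auto simp: indicator_def)
      finally show ?thesis by (simp add: N)
    qed
    then have 1: "\<rho> x ^ DIM('a) \<le> N / (l * \<omega>)"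
      using N l \<omega> by (simp add: field_simps)
    show ?thesis
    proof (cases "\<rho> x \<le> 1")
      case False
      then have "\<rho> x \<le> \<rho> x ^ DIM('a)" by (intro self_le_power) auto
      with 1 show ?thesis by (simp add: R_def)
    qed (simp add: R_def)
  qed
  obtain C where C: "countable C" "C \<subseteq> E"
    "pairwise (\<lambda>i j. disjnt (cball i (\<rho> i)) (cball j (\<rho> j))) C"
    "\<And>i. i \<in> E \<Longrightarrow> \<exists>j. j \<in> C \<and> \<not> disjnt (cball i (\<rho> i)) (cball j (\<rho> j)) \<and> cball i (\<rho> i) \<subseteq> ball j (5 * \<rho> j)"
    using Vitali_covering_lemma_cballs_balls[of E \<rho> R "\<lambda>x. x"] \<rho>(1) bdd by blast
  have E_sub: "E \<subseteq> (\<Union>j\<in>C. ball j (5 * \<rho> j))"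
  proof
    fix x assume "x \<in> E"
    with C(4) obtain j where "j \<in> C" "cball x (\<rho> x) \<subseteq> ball j (5 * \<rho> j)" by blast
    moreover have "x \<in> cball x (\<rho> x)" using \<rho>(1)[OF \<open>x \<in> E\<close>] by simp
    ultimately show "x \<in> (\<Union>j\<in>C. ball j (5 * \<rho> j))" by blast
  qed
  have "ennreal l * emeasure lborel E \<le> ennreal l * emeasure lborel (\<Union>j\<in>C. ball j (5 * \<rho> j))"
    using C(1) by (intro mult_left_mono emeasure_mono E_sub) (auto intro!: sets.countable_UN')
  also have "\<dots> \<le> ennreal l * (\<integral>\<^sup>+j. emeasure lborel (ball j (5 * \<rho> j)) \<partial>count_space C)"
  proof (rule mult_left_mono)
    have "emeasure lborel (\<Union>j\<in>C. ball j (5 * \<rho> j)) = (\<integral>\<^sup>+u. indicator (\<Union>j\<in>C. ball j (5 * \<rho> j)) u \<partial>lborel)"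
      using C(1) by (subst nn_integral_indicator) (auto intro!: sets.countable_UN')
    also have "\<dots> \<le> (\<integral>\<^sup>+u. \<integral>\<^sup>+j. indicator (ball j (5 * \<rho> j)) u \<partial>count_space C \<partial>lborel)"
    proof (rule nn_integral_mono)
      fix u
      show "indicator (\<Union>j\<in>C. ball j (5 * \<rho> j)) u \<le> (\<integral>\<^sup>+j. indicator (ball j (5 * \<rho> j)) u \<partial>count_space C :: ennreal)"
      proof (cases "\<exists>j\<in>C. u \<in> ball j (5 * \<rho> j)")
        case True
        then obtain j where j: "j \<in> C" "u \<in> ball j (5 * \<rho> j)" by blast
        have "(indicator (\<Union>j\<in>C. ball j (5 * \<rho> j)) u :: ennreal) = indicator (ball j (5 * \<rho> j)) u"
          using j by (auto simp: indicator_def)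
        also have "\<dots> \<le> (\<integral>\<^sup>+j. indicator (ball j (5 * \<rho> j)) u \<partial>count_space C)"
          using j(1) by (rule nn_integral_ge_point)
        finally show ?thesis .
      qed auto
    qed
    also have "\<dots> = (\<integral>\<^sup>+j. \<integral>\<^sup>+u. indicator (ball j (5 * \<rho> j)) u \<partial>lborel \<partial>count_space C)"
      using C(1) by (intro nn_integral_count_space_nn_integral borel_measurable_indicator) auto
    also have "\<dots> = (\<integral>\<^sup>+j. emeasure lborel (ball j (5 * \<rho> j)) \<partial>count_space C)"
      by simp
    finally show "emeasure lborel (\<Union>j\<in>C. ball j (5 * \<rho> j)) \<le> \<dots>" .
  qed simp
  also have "\<dots> = (\<integral>\<^sup>+j. ennreal l * emeasure lborel (ball j (5 * \<rho> j)) \<partial>count_space C)"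
    by (simp add: nn_integral_cmult)
  also have "\<dots> \<le> (\<integral>\<^sup>+j. ennreal (5 ^ DIM('a)) * (\<integral>\<^sup>+u. f u * indicator (ball j (\<rho> j)) u \<partial>lborel) \<partial>count_space C)"
  proof (rule nn_integral_mono)
    fix j assume "j \<in> space (count_space C)"
    then have j: "j \<in> E" using C(2) by auto
    have "ennreal l * emeasure lborel (ball j (5 * \<rho> j)) = ennreal (5 ^ DIM('a)) * (ennreal l * emeasure lborel (ball j (\<rho> j)))"
      using \<rho>(1)[OF j] by (subst emeasure_ball_scale[of 5 "\<rho> j" j j]) (auto simp: mult_ac)
    also have "\<dots> \<le> ennreal (5 ^ DIM('a)) * (\<integral>\<^sup>+u. f u * indicator (ball j (\<rho> j)) u \<partial>lborel)"
      using \<rho>(2)[OF j] by (intro mult_left_mono) auto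
    finally show "ennreal l * emeasure lborel (ball j (5 * \<rho> j)) \<le> \<dots>" .
  qed
  also have "\<dots> = ennreal (5 ^ DIM('a)) * (\<integral>\<^sup>+j. \<integral>\<^sup>+u. f u * indicator (ball j (\<rho> j)) u \<partial>lborel \<partial>count_space C)"
    by (simp add: nn_integral_cmult)
  also have "(\<integral>\<^sup>+j. \<integral>\<^sup>+u. f u * indicator (ball j (\<rho> j)) u \<partial>lborel \<partial>count_space C)
      = (\<integral>\<^sup>+u. \<integral>\<^sup>+j. f u * indicator (ball j (\<rho> j)) u \<partial>count_space C \<partial>lborel)"
  proof (rule nn_integral_count_space_nn_integral[symmetric, OF C(1)])
    fix j
    have [measurable]: "ball j (\<rho> j) \<in> sets borel" by simp
    show "(\<lambda>u. f u * indicator (ball j (\<rho> j)) u) \<in> borel_measurable lborel" by measurable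
  qed
  also have "\<dots> \<le> (\<integral>\<^sup>+u. f u \<partial>lborel)"
  proof (rule nn_integral_mono)
    fix u
    have "(\<integral>\<^sup>+j. f u * indicator (ball j (\<rho> j)) u \<partial>count_space C) = f u * (\<integral>\<^sup>+j. indicator (ball j (\<rho> j)) u \<partial>count_space C)"
      by (simp add: nn_integral_cmult)
    also have "(\<integral>\<^sup>+j. indicator (ball j (\<rho> j)) u \<partial>count_space C) \<le> 1"
    proof (cases "\<exists>j\<in>C. u \<in> ball j (\<rho> j)")
      case True
      then obtain j where j: "j \<in> C" "u \<in> ball j (\<rho> j)" by blast
      have "indicator (ball i (\<rho> i)) u = (indicator {j} i :: ennreal)" if "i \<in> C" for i
      proof (cases "i = j")
        case False
        then have "disjnt (cball i (\<rho> i)) (cball j (\<rho> j))"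
          using C(3) that j by (auto simp: pairwise_def)
        then have "u \<notin> ball i (\<rho> i)"
          using j(2) ball_subset_cball unfolding disjnt_def by blast
        with False show ?thesis by simp
      qed (use j in simp)
      then have "(\<integral>\<^sup>+i. indicator (ball i (\<rho> i)) u \<partial>count_space C) = (\<integral>\<^sup>+i. indicator {j} i \<partial>count_space C)"
        by (intro nn_integral_cong) auto
      also have "\<dots> = 1" using j by simp
      finally show ?thesis by simp
    next
      case False
      then have "(\<integral>\<^sup>+i. indicator (ball i (\<rho> i)) u \<partial>count_space C) = (\<integral>\<^sup>+i. 0 \<partial>count_space C)"
        by (intro nn_integral_cong) auto
      then show ?thesis by simp
    qed
    then have "f u * (\<integral>\<^sup>+j. indicator (ball j (\<rho> j)) u \<partial>count_space C) \<le> f u * 1"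
      by (intro mult_left_mono) auto
    finally show "(\<integral>\<^sup>+j. f u * indicator (ball j (\<rho> j)) u \<partial>count_space C) \<le> f u" by simp
  qed
  finally show ?thesis
    unfolding E_def by (simp add: mult_left_mono)
qed


text \<open>
  Averages of the part of \<open>f\<close> below \<open>c\<close> are at most \<open>c\<close>.  With \<open>c = l\<close>, the maximal function exceeds
  \<open>2 * l\<close> only where that of the part of \<open>f\<close> above \<open>l\<close> exceeds \<open>l\<close>, which improves the weak type bound.
\<close>

lemma maximal_function_truncate:
  fixes f :: "'a::euclidean_space \<Rightarrow> ennreal"
  assumes [measurable]: "f \<in> borel_measurable borel"
  shows "maximal_function f x \<le> maximal_function (\<lambda>u. f u * indicator {u. c < f u} u) x + c"
  unfolding maximal_function_def
proof (rule SUP_least)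
  fix r :: real assume r: "r \<in> {r \<in> \<rat>. 0 < r}"
  let ?e = "emeasure lborel (ball x r)"
  let ?g = "\<lambda>u. f u * indicator {u. c < f u} u"
  have [measurable]: "ball x r \<in> sets borel" by simp
  have "(\<integral>\<^sup>+u. f u * indicator (ball x r) u \<partial>lborel)
      \<le> (\<integral>\<^sup>+u. ?g u * indicator (ball x r) u + c * indicator (ball x r) u \<partial>lborel)"
    by (intro nn_integral_mono) (auto simp: indicator_def not_less)
  also have "\<dots> = (\<integral>\<^sup>+u. ?g u * indicator (ball x r) u \<partial>lborel) + c * ?e"
  proof (subst nn_integral_add)
    show "(\<lambda>u. ?g u * indicator (ball x r) u) \<in> borel_measurable lborel" by measurable
    show "(\<lambda>u. c * indicator (ball x r) u) \<in> borel_measurable lborel" by measurable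
  qed (simp add: nn_integral_cmult_indicator)
  finally have "(\<integral>\<^sup>+u. f u * indicator (ball x r) u \<partial>lborel) / ?e
      \<le> ((\<integral>\<^sup>+u. ?g u * indicator (ball x r) u \<partial>lborel) + c * ?e) / ?e"
    by (rule divide_right_mono_ennreal)
  also have "\<dots> = (\<integral>\<^sup>+u. ?g u * indicator (ball x r) u \<partial>lborel) / ?e + c"
    using emeasure_ball_pos[of r x] emeasure_ball_finite[of x r] r
    by (auto simp: add_divide_distrib_ennreal ennreal_mult_divide_eq less_top)
  also have "\<dots> \<le> (SUP r\<in>{r\<in>\<rat>. 0 < r}. (\<integral>\<^sup>+u. ?g u * indicator (ball x r) u \<partial>lborel) / emeasure lborel (ball x r)) + c"
    using r by (intro add_right_mono SUP_upper)
  finally show "(\<integral>\<^sup>+u. f u * indicator (ball x r) u \<partial>lborel) / ?e \<le> \<dots>" .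
qed

text \<open>
  One inequality of the layer cake formula for a square, with levels doubled to match the splitting of \<open>f\<close> at half
  the level.  The value \<open>\<infinity>\<close> is included, since a maximal function may take it.
\<close>

lemma square_le_layer_integral:
  "m\<^sup>2 \<le> (\<integral>\<^sup>+l. ennreal (8 * l) * indicator {l. 0 < l \<and> ennreal (2 * l) < m} l \<partial>lborel)"
proof -
  have fin: "ennreal (a\<^sup>2) \<le> (\<integral>\<^sup>+l. ennreal (8 * l) * indicator {l. 0 < l \<and> ennreal (2 * l) < m} l \<partial>lborel)"
    if a: "0 \<le> a" "ennreal a \<le> m" for a
  proof -
    have "(\<integral>\<^sup>+l. ennreal (8 * l) * indicator {0..a/2} l \<partial>lborel) = ennreal (4 * (a/2)\<^sup>2 - 4 * 0\<^sup>2)"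
      using a by (intro nn_integral_FTC_Icc) (auto intro!: derivative_eq_intros)
    also have "4 * (a/2)\<^sup>2 - 4 * 0\<^sup>2 = a\<^sup>2" by (simp add: power2_eq_square)
    finally have "ennreal (a\<^sup>2) = (\<integral>\<^sup>+l. ennreal (8 * l) * indicator {0..a/2} l \<partial>lborel)" ..
    also have "\<dots> = (\<integral>\<^sup>+l. ennreal (8 * l) * indicator {0<..<a/2} l \<partial>lborel)"
    proof (rule nn_integral_cong_AE)
      have "AE l in lborel. l \<notin> {0, a/2}"
        by (rule AE_not_in) (auto intro: finite_imp_null_set_lborel)
      then show "AE l in lborel. ennreal (8 * l) * indicator {0..a/2} l = ennreal (8 * l) * indicator {0<..<a/2} l"
        by eventually_elim (auto simp: indicator_def)
    qed
    also have "\<dots> \<le> (\<integral>\<^sup>+l. ennreal (8 * l) * indicator {l. 0 < l \<and> ennreal (2 * l) < m} l \<partial>lborel)"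
    proof (rule nn_integral_mono)
      fix l :: real
      have "ennreal (2 * l) < m" if "0 < l" "l < a / 2"
      proof -
        have "ennreal (2 * l) < ennreal a" using that by (simp add: ennreal_less_iff)
        with a show ?thesis by simp
      qed
      then show "ennreal (8 * l) * indicator {0<..<a/2} l
          \<le> ennreal (8 * l) * indicator {l. 0 < l \<and> ennreal (2 * l) < m} l"
        by (auto simp: indicator_def)
    qed
    finally show ?thesis .
  qed
  show ?thesis
  proof (cases m)
    case (real a)
    then show ?thesis using fin[of a] by (simp add: ennreal_power)
  next
    case top
    show ?thesis
    proof (cases "\<integral>\<^sup>+l. ennreal (8 * l) * indicator {l. 0 < l \<and> ennreal (2 * l) < m} l \<partial>lborel")
      case (real b)
      with fin[of "b + 1"] top have "(b + 1)\<^sup>2 \<le> b" by simp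
      with \<open>0 \<le> b\<close> have False using zero_le_power2[of b] unfolding power2_sum by simp
      then show ?thesis ..
    qed simp
  qed
qed

lemma layer_length_le: "(\<integral>\<^sup>+l. indicator {l. 0 < l \<and> ennreal l < m} l \<partial>lborel) \<le> m"
proof (cases m)
  case (real a)
  have "{l. 0 < l \<and> ennreal l < m} = {0<..<a}"
    using real by (auto simp: ennreal_less_iff)
  then show ?thesis using real by simp
qed simp

text \<open>
  Marcinkiewicz interpolation between the weak type bound and the trivial bound on bounded functions:
  the weak type bound for the part of \<open>f\<close> above \<open>l\<close> is integrated over the levels \<open>l\<close>.
\<close>

proposition maximal_function_L2:
  fixes f :: "'a::euclidean_space \<Rightarrow> ennreal"
  assumes [measurable]: "f \<in> borel_measurable borel"
  shows "(\<integral>\<^sup>+x. (maximal_function f x)\<^sup>2 \<partial>lborel) \<le> ennreal (8 * 5 ^ DIM('a)) * (\<integral>\<^sup>+x. (f x)\<^sup>2 \<partial>lborel)"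
proof -
  note maximal_function_measurable[OF assms, measurable]
  let ?M = "maximal_function f"
  have "(\<integral>\<^sup>+x. (?M x)\<^sup>2 \<partial>lborel)
      \<le> (\<integral>\<^sup>+x. \<integral>\<^sup>+l. ennreal (8 * l) * indicator {l. 0 < l \<and> ennreal (2 * l) < ?M x} l \<partial>lborel \<partial>lborel)"
    by (intro nn_integral_mono square_le_layer_integral)
  also have "\<dots> = (\<integral>\<^sup>+x. \<integral>\<^sup>+l. ennreal (8 * l) * indicator {p. 0 < snd p \<and> ennreal (2 * snd p) < ?M (fst p)} (x, l) \<partial>lborel \<partial>lborel)"
    by (simp add: indicator_def)
  also have "\<dots> = (\<integral>\<^sup>+l. \<integral>\<^sup>+x. ennreal (8 * l) * indicator {p. 0 < snd p \<and> ennreal (2 * snd p) < ?M (fst p)} (x, l) \<partial>lborel \<partial>lborel)"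
    by (rule lborel_pair.Fubini'[symmetric]) measurable
  also have "\<dots> \<le> (\<integral>\<^sup>+l. \<integral>\<^sup>+x. ennreal (8 * 5 ^ DIM('a)) * (f x * indicator {p. 0 < snd p \<and> ennreal (snd p) < f (fst p)} (x, l)) \<partial>lborel \<partial>lborel)"
  proof (rule nn_integral_mono)
    fix l :: real
    let ?g = "\<lambda>u. f u * indicator {u. ennreal l < f u} u"
    show "(\<integral>\<^sup>+x. ennreal (8 * l) * indicator {p. 0 < snd p \<and> ennreal (2 * snd p) < ?M (fst p)} (x, l) \<partial>lborel)
        \<le> (\<integral>\<^sup>+x. ennreal (8 * 5 ^ DIM('a)) * (f x * indicator {p. 0 < snd p \<and> ennreal (snd p) < f (fst p)} (x, l)) \<partial>lborel)"
    proof (cases "0 < l")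
      case True
      have sub: "{x. ennreal (2 * l) < ?M x} \<subseteq> {x. ennreal l < maximal_function ?g x}"
      proof safe
        fix x assume "ennreal (2 * l) < ?M x"
        also have "?M x \<le> maximal_function ?g x + ennreal l"
          by (rule maximal_function_truncate) measurable
        finally have "ennreal l + ennreal l < maximal_function ?g x + ennreal l"
          using True by (simp flip: ennreal_plus)
        then show "ennreal l < maximal_function ?g x"
          by (metis add_right_mono not_less)
      qed
      have "maximal_function ?g \<in> borel_measurable borel" by measurable
      note [measurable] = this
      have "(\<integral>\<^sup>+x. ennreal (8 * l) * indicator {p. 0 < snd p \<and> ennreal (2 * snd p) < ?M (fst p)} (x, l) \<partial>lborel)
          = (\<integral>\<^sup>+x. ennreal (8 * l) * indicator {x. ennreal (2 * l) < ?M x} x \<partial>lborel)"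
        using True by (simp add: indicator_def)
      also have "\<dots> = ennreal (8 * l) * emeasure lborel {x. ennreal (2 * l) < ?M x}"
        by (subst nn_integral_cmult_indicator) auto
      also have "\<dots> \<le> ennreal (8 * l) * emeasure lborel {x. ennreal l < maximal_function ?g x}"
        by (intro mult_left_mono emeasure_mono sub) auto
      also have "\<dots> = 8 * (ennreal l * emeasure lborel {x. ennreal l < maximal_function ?g x})"
        using True by (simp add: ennreal_mult mult.assoc)
      also have "\<dots> \<le> 8 * (ennreal (5 ^ DIM('a)) * (\<integral>\<^sup>+u. ?g u \<partial>lborel))"
        using True by (intro mult_left_mono maximal_function_weak_type) auto
      also have "\<dots> = ennreal (8 * 5 ^ DIM('a)) * (\<integral>\<^sup>+u. ?g u \<partial>lborel)"
        by (simp add: ennreal_mult mult.assoc)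
      also have "\<dots> = (\<integral>\<^sup>+x. ennreal (8 * 5 ^ DIM('a)) * (f x * indicator {p. 0 < snd p \<and> ennreal (snd p) < f (fst p)} (x, l)) \<partial>lborel)"
        using True by (subst nn_integral_cmult) (auto simp: indicator_def)
      finally show ?thesis .
    qed simp
  qed
  also have "\<dots> = (\<integral>\<^sup>+x. \<integral>\<^sup>+l. ennreal (8 * 5 ^ DIM('a)) * (f x * indicator {p. 0 < snd p \<and> ennreal (snd p) < f (fst p)} (x, l)) \<partial>lborel \<partial>lborel)"
    by (rule lborel_pair.Fubini') measurable
  also have "\<dots> = (\<integral>\<^sup>+x. ennreal (8 * 5 ^ DIM('a)) * (f x * (\<integral>\<^sup>+l. indicator {l. 0 < l \<and> ennreal l < f x} l \<partial>lborel)) \<partial>lborel)"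
    by (simp add: nn_integral_cmult indicator_def)
  also have "\<dots> \<le> (\<integral>\<^sup>+x. ennreal (8 * 5 ^ DIM('a)) * (f x * f x) \<partial>lborel)"
    by (intro nn_integral_mono mult_left_mono layer_length_le) auto
  also have "\<dots> = ennreal (8 * 5 ^ DIM('a)) * (\<integral>\<^sup>+x. (f x)\<^sup>2 \<partial>lborel)"
    by (subst nn_integral_cmult) (auto simp: power2_eq_square)
  finally show ?thesis .
qed

section \<open>Mean value inequalities on tube domains\<close>

lemma complex_vec_slice:
  "complex_vec x y + z *s complex_vec a b
     = complex_vec (x + Re z *\<^sub>R a - Im z *\<^sub>R b) (y + Re z *\<^sub>R b + Im z *\<^sub>R a)"
  by (simp add: complex_vec_def vec_eq_iff complex_eq_iff)

lemma complex_vec_in_tube_iff [simp]: "complex_vec x y \<in> tube S \<longleftrightarrow> y \<in> S"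
proof
  assume "complex_vec x y \<in> tube S"
  then obtain u v where uv: "complex_vec x y = complex_vec u v" "v \<in> S"
    unfolding tube_def by blast
  then have "y = v"
    by (auto simp: complex_vec_def vec_eq_iff)
  with uv show "y \<in> S" by simp
qed (auto simp: tube_def)

text \<open>
  All of the one-variable theory enters through this restriction to complex lines.
\<close>

lemma holomorphic_slice:
  assumes F: "holomorphic_vec_on F (tube S)"
    and U: "\<And>z. z \<in> U \<Longrightarrow> y + Re z *\<^sub>R b + Im z *\<^sub>R a \<in> S"
  shows "(\<lambda>z. F (complex_vec x y + z *s complex_vec a b)) holomorphic_on U"
  unfolding holomorphic_on_def field_differentiable_def
proof
  fix z assume z: "z \<in> U"
  let ?v = "complex_vec a b"
  let ?h = "\<lambda>z. complex_vec x y + z *s ?v"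
  have sub: "?h ` U \<subseteq> tube S"
    using U by (auto simp: complex_vec_slice)
  then obtain L where L: "(F has_derivative L) (at (?h z) within tube S)" "\<And>c v. L (c *s v) = c * L v"
    using F z unfolding holomorphic_vec_on_def by blast
  have "bounded_linear (\<lambda>w. w *s ?v)"
    unfolding linear_conv_bounded_linear[symmetric]
    by (rule linearI) (simp_all add: vec_eq_iff algebra_simps)
  then have "(?h has_derivative (\<lambda>w. w *s ?v)) (at z within U)"
    using has_derivative_add[OF has_derivative_const bounded_linear_imp_has_derivative] by fastforce
  from diff_chain_within[OF this has_derivative_subset[OF L(1) sub]]
  have "((\<lambda>z. F (?h z)) has_derivative (\<lambda>w. L ?v * w)) (at z within U)"
    by (simp add: o_def L(2) mult.commute)
  then show "\<exists>D. ((\<lambda>z. F (?h z)) has_field_derivative D) (at z within U)"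
    unfolding has_field_derivative_def by blast
qed

lemma continuous_on_complex_vec: "continuous_on A (\<lambda>p. complex_vec (fst p) (snd p))"
  unfolding complex_vec_def Complex_eq by (intro continuous_intros)

lemma holomorphic_vec_continuous_on:
  assumes "holomorphic_vec_on F (tube S)"
  shows "continuous_on (UNIV \<times> S) (\<lambda>p. F (complex_vec (fst p) (snd p)))"
proof (rule continuous_on_compose2[OF _ continuous_on_complex_vec])
  show "continuous_on (tube S) F"
    using assms has_derivative_continuous
    unfolding holomorphic_vec_on_def continuous_on_eq_continuous_within by blast
qed auto

text \<open>
  Multiplication by a complex scalar, with complex vectors written as pairs of real and imaginary part.
\<close>

definition complex_scale :: "complex \<Rightarrow> ('a::real_vector \<times> 'a) \<Rightarrow> 'a \<times> 'a" where
  "complex_scale c p = (Re c *\<^sub>R fst p - Im c *\<^sub>R snd p, Re c *\<^sub>R snd p + Im c *\<^sub>R fst p)"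

lemma complex_scale_mult: "complex_scale (c * d) p = complex_scale c (complex_scale d p)"
  by (simp add: complex_scale_def algebra_simps)

lemma norm_complex_scale:
  fixes p :: "'a::real_inner \<times> 'a"
  shows "norm (complex_scale c p) = cmod c * norm p"
proof -
  have "(norm (complex_scale c p))\<^sup>2 = (cmod c * norm p)\<^sup>2"
    unfolding power_mult_distrib cmod_power2
    unfolding power2_norm_eq_inner complex_scale_def inner_prod_def
    by (simp add: inner_add_left inner_add_right inner_diff_left inner_diff_right
        inner_commute algebra_simps power2_eq_square)
  then show ?thesis by (simp add: power2_eq_iff_nonneg)
qed

lemma complex_scale_measurable [measurable]:
  "complex_scale c \<in> borel_measurable (borel :: ('a::euclidean_space \<times> 'a) measure)"
  unfolding complex_scale_def
  by (intro borel_measurable_continuous_onI continuous_intros)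

lemma nn_integral_lborel_translate:
  fixes g :: "'a::euclidean_space \<Rightarrow> ennreal"
  assumes [measurable]: "g \<in> borel_measurable borel"
  shows "(\<integral>\<^sup>+x. g (x + c) \<partial>lborel) = (\<integral>\<^sup>+x. g x \<partial>lborel)"
proof -
  have "(\<integral>\<^sup>+x. g x \<partial>lborel) = (\<integral>\<^sup>+x. g x \<partial>distr lborel borel ((+) c))"
    by (simp add: lborel_distr_plus)
  also have "\<dots> = (\<integral>\<^sup>+x. g (c + x) \<partial>lborel)"
    by (subst nn_integral_distr) auto
  finally show ?thesis by (simp add: add.commute)
qed

lemma nn_integral_shear_fst:
  fixes g :: "('a::euclidean_space \<times> 'a) \<Rightarrow> ennreal"
  assumes g: "g \<in> borel_measurable borel"
  shows "(\<integral>\<^sup>+p. g (fst p + k *\<^sub>R snd p, snd p) \<partial>lborel) = (\<integral>\<^sup>+p. g p \<partial>lborel)"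
proof -
  have [measurable]: "g \<in> borel_measurable (borel \<Otimes>\<^sub>M borel)" using g by (simp add: borel_prod)
  have "(\<integral>\<^sup>+p. g (fst p + k *\<^sub>R snd p, snd p) \<partial>lborel)
      = (\<integral>\<^sup>+p. g (fst p + k *\<^sub>R snd p, snd p) \<partial>(lborel \<Otimes>\<^sub>M lborel))"
    by (simp add: lborel_prod)
  also have "\<dots> = (\<integral>\<^sup>+b. \<integral>\<^sup>+a. g (a + k *\<^sub>R b, b) \<partial>lborel \<partial>lborel)"
    by (subst lborel_pair.nn_integral_snd[symmetric]) (simp_all, measurable)
  also have "\<dots> = (\<integral>\<^sup>+b. \<integral>\<^sup>+a. g (a, b) \<partial>lborel \<partial>lborel)"
    by (intro nn_integral_cong nn_integral_lborel_translate[where g = "\<lambda>a. g (a, _)"]) measurable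
  also have "\<dots> = (\<integral>\<^sup>+p. g p \<partial>(lborel \<Otimes>\<^sub>M lborel))"
    by (rule lborel_pair.nn_integral_snd) measurable
  finally show ?thesis by (simp add: lborel_prod)
qed

lemma nn_integral_shear_snd:
  fixes g :: "('a::euclidean_space \<times> 'a) \<Rightarrow> ennreal"
  assumes g: "g \<in> borel_measurable borel"
  shows "(\<integral>\<^sup>+p. g (fst p, snd p + k *\<^sub>R fst p) \<partial>lborel) = (\<integral>\<^sup>+p. g p \<partial>lborel)"
proof -
  have [measurable]: "g \<in> borel_measurable (borel \<Otimes>\<^sub>M borel)" using g by (simp add: borel_prod)
  have "(\<integral>\<^sup>+p. g (fst p, snd p + k *\<^sub>R fst p) \<partial>lborel)
      = (\<integral>\<^sup>+p. g (fst p, snd p + k *\<^sub>R fst p) \<partial>(lborel \<Otimes>\<^sub>M lborel))"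
    by (simp add: lborel_prod)
  also have "\<dots> = (\<integral>\<^sup>+a. \<integral>\<^sup>+b. g (a, b + k *\<^sub>R a) \<partial>lborel \<partial>lborel)"
    by (subst lborel.nn_integral_fst[symmetric]) (simp_all, measurable)
  also have "\<dots> = (\<integral>\<^sup>+a. \<integral>\<^sup>+b. g (a, b) \<partial>lborel \<partial>lborel)"
    by (intro nn_integral_cong nn_integral_lborel_translate[where g = "\<lambda>b. g (_, b)"]) measurable
  also have "\<dots> = (\<integral>\<^sup>+p. g p \<partial>(lborel \<Otimes>\<^sub>M lborel))"
    by (rule lborel.nn_integral_fst) measurable
  finally show ?thesis by (simp add: lborel_prod)
qed

text \<open>
  A rotation by an angle \<open>\<theta>\<close> other than \<open>\<pi>\<close> is the product of three shears, with factors
  \<open>- tan (\<theta>/2)\<close>, \<open>sin \<theta>\<close> and \<open>- tan (\<theta>/2)\<close>; each of them preserves Lebesgue measure by Fubini and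
  translation invariance.  The half turn is the square of a quarter turn.
\<close>

lemma nn_integral_complex_scale:
  fixes g :: "('a::euclidean_space \<times> 'a) \<Rightarrow> ennreal"
  assumes g: "g \<in> borel_measurable borel" and c: "cmod c = 1"
  shows "(\<integral>\<^sup>+p. g (complex_scale c p) \<partial>lborel) = (\<integral>\<^sup>+p. g p \<partial>lborel)"
proof -
  have *: "(\<integral>\<^sup>+p. g (complex_scale c p) \<partial>lborel) = (\<integral>\<^sup>+p. g p \<partial>lborel)"
    if g: "g \<in> borel_measurable borel" and c: "cmod c = 1" "c \<noteq> -1" for c and g :: "('a \<times> 'a) \<Rightarrow> ennreal"
  proof -
    \<comment> \<open>\<open>k\<close> is \<open>- tan (\<theta>/2)\<close> for \<open>c = exp (\<i> * \<theta>)\<close>\<close>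
    define k where "k = - Im c / (1 + Re c)"
    have sq: "(Re c)\<^sup>2 + (Im c)\<^sup>2 = 1"
      using c(1) by (metis cmod_power2 one_power2)
    have ne: "1 + Re c \<noteq> 0"
    proof
      assume "1 + Re c = 0"
      then have "Re c = -1" by simp
      with sq have "Im c = 0" by simp
      with \<open>Re c = -1\<close> c(2) show False by (simp add: complex_eq_iff)
    qed
    have 1: "1 + Im c * k = Re c" and 2: "k * (1 + Re c) = - Im c"
      using ne sq by (simp_all add: k_def field_simps power2_eq_square)
    let ?S = "\<lambda>p::'a \<times> 'a. (fst p + k *\<^sub>R snd p, snd p)"
    let ?T = "\<lambda>p::'a \<times> 'a. (fst p, snd p + Im c *\<^sub>R fst p)"
    have meas: "?S \<in> borel_measurable borel" "?T \<in> borel_measurable borel"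
      by (intro borel_measurable_continuous_onI continuous_intros)+
    have "complex_scale c p = ?S (?T (?S p))" for p :: "'a \<times> 'a"
    proof -
      have b: "snd p + Im c *\<^sub>R (fst p + k *\<^sub>R snd p) = Re c *\<^sub>R snd p + Im c *\<^sub>R fst p"
        unfolding 1[symmetric] by (simp add: algebra_simps)
      have "fst p + k *\<^sub>R snd p + k *\<^sub>R (Re c *\<^sub>R snd p + Im c *\<^sub>R fst p)
          = (1 + Im c * k) *\<^sub>R fst p + (k * (1 + Re c)) *\<^sub>R snd p"
        by (simp add: algebra_simps)
      also have "\<dots> = Re c *\<^sub>R fst p - Im c *\<^sub>R snd p"
        unfolding 1 2 by simp
      finally show ?thesis using b by (simp add: complex_scale_def)
    qed
    then have "(\<integral>\<^sup>+p. g (complex_scale c p) \<partial>lborel) = (\<integral>\<^sup>+p. g (?S (?T (?S p))) \<partial>lborel)"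
      by (simp only:)
    also have "\<dots> = (\<integral>\<^sup>+p. g (?S (?T p)) \<partial>lborel)"
      using nn_integral_shear_fst[of "\<lambda>p. g (?S (?T p))" k] g meas
      by (simp only: measurable_compose[OF measurable_compose[OF meas(2) meas(1)] g] simp_thms)
    also have "\<dots> = (\<integral>\<^sup>+p. g (?S p) \<partial>lborel)"
      using nn_integral_shear_snd[of "\<lambda>p. g (?S p)" "Im c"]
      by (simp only: measurable_compose[OF meas(1) g] simp_thms)
    also have "\<dots> = (\<integral>\<^sup>+p. g p \<partial>lborel)"
      by (rule nn_integral_shear_fst[OF g])
    finally show ?thesis .
  qed
  show ?thesis
  proof (cases "c = -1")
    case False then show ?thesis by (intro * g c)
  next
    case True
    then have "c = \<i> * \<i>" by simp
    then have "(\<integral>\<^sup>+p. g (complex_scale c p) \<partial>lborel) = (\<integral>\<^sup>+p. g (complex_scale \<i> (complex_scale \<i> p)) \<partial>lborel)"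
      by (simp only: complex_scale_mult)
    also have "\<dots> = (\<integral>\<^sup>+p. g (complex_scale \<i> p) \<partial>lborel)"
      by (rule *[where g = "\<lambda>p. g (complex_scale \<i> p)"])
         (auto simp: complex_eq_iff intro: measurable_compose[OF complex_scale_measurable g])
    also have "\<dots> = (\<integral>\<^sup>+p. g p \<partial>lborel)"
      by (rule *[OF g]) (auto simp: complex_eq_iff)
    finally show ?thesis .
  qed
qed

text \<open>
  The inequality on the disc is applied to \<open>w \<mapsto> F (z + w q)\<close> and averaged over \<open>q\<close> in the ball, which is
  invariant under multiplication of \<open>q\<close> by complex numbers of modulus one.
\<close>

proposition power_submean_ball:
  fixes F :: "complex ^ 'n::finite \<Rightarrow> complex"
  assumes F: "holomorphic_vec_on F (tube S)" and S: "ball y r \<subseteq> S" and s: "0 < s"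
  shows "ennreal (cmod (F (complex_vec x y)) powr s) * emeasure lborel (ball (x, y) r)
    \<le> (\<integral>\<^sup>+p. ennreal (cmod (F (complex_vec (fst p) (snd p))) powr s) * indicator (ball (x, y) r) p \<partial>lborel)"
proof -
  let ?\<Phi> = "\<lambda>p. ennreal (cmod (F (complex_vec (fst p) (snd p))) powr s) * indicator (ball (x, y) r) p"
  let ?R = "\<lambda>(q, t). (x, y) + complex_scale (cayley t) q"
  have ball_sub: "ball (x, y) r \<subseteq> UNIV \<times> S"
  proof
    fix p assume "p \<in> ball (x, y) r"
    then have "snd p \<in> ball y r"
      using dist_snd_le[of "(x, y)" p] by simp
    then show "p \<in> UNIV \<times> S"
      using S by (cases p) auto
  qed
  have \<Phi> [measurable]: "?\<Phi> \<in> borel_measurable borel"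
  proof -
    have "continuous_on (ball (x, y) r) (\<lambda>p. cmod (F (complex_vec (fst p) (snd p))) powr s)"
      using s by (intro continuous_on_powr' continuous_intros
          continuous_on_subset[OF holomorphic_vec_continuous_on[OF F] ball_sub]) auto
    then have "(\<lambda>p. indicator (ball (x, y) r) p *\<^sub>R cmod (F (complex_vec (fst p) (snd p))) powr s) \<in> borel_measurable borel"
      by (intro borel_measurable_continuous_on_indicator) auto
    then have "(\<lambda>p. ennreal (indicator (ball (x, y) r) p *\<^sub>R cmod (F (complex_vec (fst p) (snd p))) powr s)) \<in> borel_measurable borel"
      by measurable
    moreover have "(\<lambda>p. ennreal (indicator (ball (x, y) r) p *\<^sub>R cmod (F (complex_vec (fst p) (snd p))) powr s)) = ?\<Phi>"
      by (auto simp: fun_eq_iff indicator_def)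
    ultimately show ?thesis by (simp only:)
  qed
  have "continuous_on UNIV ?R"
    unfolding complex_scale_def split_beta'
    by (intro continuous_intros continuous_on_compose2[OF continuous_on_cayley[of UNIV]]) auto
  then have R [measurable]: "?R \<in> borel_measurable (lborel \<Otimes>\<^sub>M borel)"
  proof -
    assume "continuous_on UNIV ?R"
    then have "?R \<in> borel_measurable (borel \<Otimes>\<^sub>M borel)"
      unfolding borel_prod by (rule borel_measurable_continuous_onI)
    then show ?thesis
      by (subst measurable_cong_sets[OF sets_pair_measure_cong[OF sets_lborel refl] refl])
  qed
  have *: "ennreal (cmod (F (complex_vec x y)) powr s) * indicator (ball 0 r) q
      \<le> (\<integral>\<^sup>+t. ?\<Phi> (?R (q, t)) \<partial>cauchy_measure)" for q
  proof (cases "q \<in> ball 0 r")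
    case True
    obtain a b where q: "q = (a, b)" by fastforce
    let ?f = "\<lambda>w. F (complex_vec x y + w *s complex_vec a b)"
    have in_ball: "(x, y) + complex_scale w q \<in> ball (x, y) r" if "cmod w \<le> 1" for w
    proof -
      have "dist (x, y) ((x, y) + complex_scale w q) = cmod w * norm q"
        by (simp add: dist_norm norm_complex_scale)
      also have "\<dots> \<le> 1 * norm q" using that by (intro mult_right_mono) auto
      finally show ?thesis using True by simp
    qed
    have holf: "?f holomorphic_on cball 0 1"
    proof (rule holomorphic_slice[OF F])
      fix z :: complex assume "z \<in> cball 0 1"
      then have "(x, y) + complex_scale z q \<in> UNIV \<times> S"
        using in_ball[of z] ball_sub by auto
      then show "y + Re z *\<^sub>R b + Im z *\<^sub>R a \<in> S"
        by (simp add: complex_scale_def q add.assoc)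
    qed
    have "ennreal (cmod (?f 0) powr s) \<le> (\<integral>\<^sup>+t. ennreal (cmod (?f (cayley t)) powr s) \<partial>cauchy_measure)"
      by (rule power_submean_disc[OF holomorphic_on_imp_continuous_on[OF holf] holomorphic_on_subset[OF holf] s]) auto
    also have "(\<lambda>t. ennreal (cmod (?f (cayley t)) powr s)) = (\<lambda>t. ?\<Phi> (?R (q, t)))"
    proof
      fix t
      show "ennreal (cmod (?f (cayley t)) powr s) = ?\<Phi> (?R (q, t))"
        using in_ball[of "cayley t"]
        by (simp add: complex_vec_slice complex_scale_def q algebra_simps)
    qed
    finally show ?thesis using True by simp
  qed simp
  have "ennreal (cmod (F (complex_vec x y)) powr s) * emeasure lborel (ball (x, y) r)
      = (\<integral>\<^sup>+q. ennreal (cmod (F (complex_vec x y)) powr s) * indicator (ball 0 r) q \<partial>(lborel :: ((real^'n) \<times> (real^'n)) measure))"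
    by (subst nn_integral_cmult_indicator) (auto simp: emeasure_lborel_ball_center[of "(x, y)" r])
  also have "\<dots> \<le> (\<integral>\<^sup>+q. \<integral>\<^sup>+t. ?\<Phi> (?R (q, t)) \<partial>cauchy_measure \<partial>lborel)"
    by (intro nn_integral_mono *)
  also have "\<dots> = (\<integral>\<^sup>+t. \<integral>\<^sup>+q. ?\<Phi> (?R (q, t)) \<partial>lborel \<partial>cauchy_measure)"
  proof -
    interpret pair_sigma_finite "lborel :: ((real^'n) \<times> (real^'n)) measure" cauchy_measure ..
    have "(\<lambda>p. ?\<Phi> (?R p)) \<in> borel_measurable (lborel \<Otimes>\<^sub>M cauchy_measure)"
      by (rule measurable_compose[OF _ \<Phi>]) (use R in \<open>simp cong: measurable_cong_sets\<close>)
    then show ?thesis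
      by (intro Fubini'[symmetric]) (simp add: split_beta')
  qed
  also have "\<dots> = (\<integral>\<^sup>+t. \<integral>\<^sup>+p. ?\<Phi> p \<partial>lborel \<partial>cauchy_measure)"
  proof (rule nn_integral_cong)
    fix t
    have "(\<lambda>q. q + (x, y)) \<in> borel_measurable borel" by measurable
    note meas = measurable_compose[OF this \<Phi>]
    have "(\<integral>\<^sup>+q. ?\<Phi> (?R (q, t)) \<partial>lborel) = (\<integral>\<^sup>+q. ?\<Phi> (complex_scale (cayley t) q + (x, y)) \<partial>lborel)"
      by (simp only: prod.case add.commute)
    also have "\<dots> = (\<integral>\<^sup>+q. ?\<Phi> (q + (x, y)) \<partial>lborel)"
      by (rule nn_integral_complex_scale[OF meas cmod_cayley])
    also have "\<dots> = (\<integral>\<^sup>+p. ?\<Phi> p \<partial>lborel)"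
      by (rule nn_integral_lborel_translate[OF \<Phi>])
    finally show "(\<integral>\<^sup>+q. ?\<Phi> (?R (q, t)) \<partial>lborel) = (\<integral>\<^sup>+p. ?\<Phi> p \<partial>lborel)" .
  qed
  also have "\<dots> = (\<integral>\<^sup>+p. ?\<Phi> p \<partial>lborel)"
    by (simp add: emeasure_cauchy_measure)
  finally show ?thesis .
qed


lemma cayley_disc_halfplane:
  assumes "cmod w \<le> 1"
  shows "0 \<le> Im (\<i> * (1 + w) / (1 - w))" (is ?A)
    and "cmod w < 1 \<Longrightarrow> 0 < Im (\<i> * (1 + w) / (1 - w))"
    and "0 < \<eta> \<Longrightarrow> (1 - w) + of_real \<eta> * (1 + w) \<noteq> 0" (is "_ \<Longrightarrow> ?B")
proof -
  have "Re w \<le> 1" "- 1 \<le> Re w" using abs_Re_le_cmod[of w] assms by auto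
  have im: "Im (\<i> * (1 + w) / (1 - w)) = (1 - (cmod w)\<^sup>2) / (cmod (1 - w))\<^sup>2"
    unfolding Im_divide cmod_power2 by (simp add: power2_eq_square algebra_simps)
  show ?A unfolding im using assms by (simp add: power_le_one)
  show "0 < Im (\<i> * (1 + w) / (1 - w))" if "cmod w < 1"
  proof -
    have "w \<noteq> 1" using that by auto
    moreover have "(cmod w)\<^sup>2 < 1" using that by (simp add: abs_square_less_1)
    ultimately show ?thesis unfolding im by (intro divide_pos_pos) auto
  qed
  show ?B if "0 < \<eta>"
  proof
    assume "(1 - w) + of_real \<eta> * (1 + w) = 0"
    then have "Re ((1 - w) + of_real \<eta> * (1 + w)) = 0" by (simp only: zero_complex.sel)
    then have "(1 - Re w) + \<eta> * (1 + Re w) = 0" by simp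
    moreover have "0 \<le> \<eta> * (1 + Re w)" using that \<open>- 1 \<le> Re w\<close> by simp
    ultimately have "Re w = 1" "\<eta> * (1 + Re w) = 0" using \<open>Re w \<le> 1\<close> by linarith+
    then show False using that by simp
  qed
qed

text \<open>
  After a Cayley transform this is the inequality on the disc, except that \<open>h\<close> need not extend
  continuously to the point at infinity.  Dividing \<open>h z\<close> by \<open>1 - \<i> * \<eta> * z\<close>, which has modulus at least one on
  the half-plane and tends to infinity, forces the limit \<open>0\<close> there; then \<open>\<eta>\<close> tends to \<open>0\<close>.
\<close>

lemma power_submean_halfplane:
  assumes holh: "h holomorphic_on {z. 0 \<le> Im z}"
    and bdd: "\<And>z. 0 \<le> Im z \<Longrightarrow> cmod (h z) \<le> K" and s: "0 < s"
  shows "ennreal (cmod (h \<i>) powr s) \<le> (\<integral>\<^sup>+t. ennreal (cmod (h (of_real t)) powr s) \<partial>cauchy_measure)"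
    (is "_ \<le> ?I")
proof -
  let ?\<phi> = "\<lambda>w. \<i> * (1 + w) / (1 - w)"
  have *: "ennreal ((cmod (h \<i>) / (1 + \<eta>)) powr s) \<le> ?I" if \<eta>: "0 < \<eta>" for \<eta>
  proof -
    define D where "D w = (1 - w) + of_real \<eta> * (1 + w)" for w :: complex
    have D: "D w \<noteq> 0" if "cmod w \<le> 1" for w
      unfolding D_def by (rule cayley_disc_halfplane(3)[OF that \<eta>])
    \<comment> \<open>\<open>(1 - w) / D w\<close> is \<open>1 / (1 - \<i> * \<eta> * z)\<close> at \<open>z = ?\<phi> w\<close>; it vanishes at \<open>w = 1\<close>\<close>
    define f where "f w = h (?\<phi> w) * ((1 - w) / D w)" for w
    have hol: "f holomorphic_on cball 0 1 - {1}"
    proof -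
      have "(h \<circ> ?\<phi>) holomorphic_on cball 0 1 - {1}"
        by (intro holomorphic_on_compose_gen[OF _ holh] holomorphic_intros)
           (use cayley_disc_halfplane(1) in auto)
      then show ?thesis
        unfolding f_def D_def
        by (intro holomorphic_intros) (use D in \<open>auto simp: o_def D_def\<close>)
    qed
    have "continuous (at w within cball 0 1) f" if w: "w \<in> cball 0 1" for w
    proof (cases "w = 1")
      case False
      have "at w within cball 0 1 = at w within (cball 0 1 - {1})"
        using False by (intro at_within_nhd[of _ "- {1}"]) auto
      then show ?thesis
        using holomorphic_on_imp_continuous_on[OF hol] w False
        by (auto simp: continuous_on_eq_continuous_within)
    next
      case True
      have "((\<lambda>w. K * cmod ((1 - w) / D w)) \<longlongrightarrow> K * cmod ((1 - 1) / D 1)) (at 1 within cball 0 1)"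
        using D[of 1] unfolding D_def by (intro tendsto_intros) auto
      then have "((\<lambda>w. K * cmod ((1 - w) / D w)) \<longlongrightarrow> 0) (at 1 within cball 0 1)" by simp
      moreover have "eventually (\<lambda>w. norm (f w) \<le> K * cmod ((1 - w) / D w)) (at 1 within cball 0 1)"
        unfolding eventually_at_filter f_def norm_mult
        by (intro always_eventually allI impI mult_right_mono bdd cayley_disc_halfplane(1)) auto
      ultimately have "(f \<longlongrightarrow> 0) (at 1 within cball 0 1)"
        by (rule Lim_null_comparison[rotated])
      then show ?thesis
        by (simp add: True continuous_within f_def)
    qed
    then have cont: "continuous_on (cball 0 1) f"
      by (simp add: continuous_on_eq_continuous_within)
    have "ennreal (cmod (f 0) powr s) \<le> (\<integral>\<^sup>+t. ennreal (cmod (f (cayley t)) powr s) \<partial>cauchy_measure)"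
      by (rule power_submean_disc[OF cont holomorphic_on_subset[OF hol] s]) auto
    also have "\<dots> \<le> ?I"
    proof (intro nn_integral_mono ennreal_leI powr_mono2)
      fix t
      have ne: "of_real t + \<i> \<noteq> 0" by (rule real_plus_i_nonzero)
      have c: "1 - cayley t = 2 * \<i> / (of_real t + \<i>)" "1 + cayley t = 2 * of_real t / (of_real t + \<i>)"
        using ne by (simp_all add: cayley_def field_simps)
      have "?\<phi> (cayley t) = of_real t"
      proof -
        have "\<i> * (2 * a / b) / (2 * \<i> / b) = a" if "b \<noteq> 0" for a b :: complex
          using that by simp
        then show ?thesis unfolding c using ne by blast
      qed
      moreover have "cmod ((1 - cayley t) / D (cayley t)) \<le> 1"
      proof -
        have "D (cayley t) = (2 * \<i> + 2 * of_real \<eta> * of_real t) / (of_real t + \<i>)"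
          unfolding D_def c by (simp add: add_divide_distrib)
        then have "(1 - cayley t) / D (cayley t) = 2 * \<i> / (2 * \<i> + 2 * of_real \<eta> * of_real t)"
          unfolding c using ne by simp
        moreover have "cmod (2 * \<i>) \<le> cmod (2 * \<i> + 2 * of_real \<eta> * of_real t)"
          using abs_Im_le_cmod[of "2 * \<i> + 2 * of_real \<eta> * of_real t"] by simp
        ultimately show ?thesis
          by (simp add: norm_divide divide_le_eq_1)
      qed
      ultimately show "cmod (f (cayley t)) \<le> cmod (h (of_real t))"
        unfolding f_def norm_mult by (simp add: mult_left_le)
    qed (use s in auto)
    also have "cmod (f 0) = cmod (h \<i>) / (1 + \<eta>)"
    proof -
      have "D 0 = of_real (1 + \<eta>)" by (simp add: D_def)
      then have "cmod (D 0) = 1 + \<eta>" using \<eta> by (simp only: norm_of_real)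
      then show ?thesis by (simp add: f_def norm_divide norm_mult)
    qed
    finally show ?thesis .
  qed
  have "(\<lambda>k. ennreal ((cmod (h \<i>) / (1 + inverse (real (Suc k)))) powr s))
      \<longlonglongrightarrow> ennreal ((cmod (h \<i>) / (1 + 0)) powr s)"
    using s by (intro tendsto_ennrealI tendsto_powr2 tendsto_divide tendsto_add tendsto_const
        LIMSEQ_inverse_real_of_nat) (auto intro!: always_eventually)
  then have "(\<lambda>k. ennreal ((cmod (h \<i>) / (1 + inverse (real (Suc k)))) powr s))
      \<longlonglongrightarrow> ennreal (cmod (h \<i>) powr s)" by simp
  then show ?thesis
    by (rule LIMSEQ_le_const2) (use * in auto)
qed

proposition power_submean_tube:
  fixes F :: "complex ^ 'n::finite \<Rightarrow> complex"
  assumes F: "holomorphic_vec_on F (tube S)" and s: "0 < s"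
    and ray: "\<And>b. 0 \<le> b \<Longrightarrow> y + b *\<^sub>R v \<in> S"
    and bdd: "\<And>b x. 0 \<le> b \<Longrightarrow> cmod (F (complex_vec x (y + b *\<^sub>R v))) \<le> K"
  shows "ennreal (cmod (F (complex_vec x (y + v))) powr s)
    \<le> (\<integral>\<^sup>+t. ennreal (cmod (F (complex_vec (x + t *\<^sub>R v) y)) powr s) \<partial>cauchy_measure)"
proof -
  let ?h = "\<lambda>z. F (complex_vec x y + z *s complex_vec v 0)"
  have "?h holomorphic_on {z. 0 \<le> Im z}"
    by (rule holomorphic_slice[OF F]) (use ray in auto)
  moreover have "cmod (?h z) \<le> K" if "0 \<le> Im z" for z
    using bdd[OF that] by (simp add: complex_vec_slice)
  ultimately have "ennreal (cmod (?h \<i>) powr s) \<le> (\<integral>\<^sup>+t. ennreal (cmod (?h (of_real t)) powr s) \<partial>cauchy_measure)"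
    by (rule power_submean_halfplane[OF _ _ s])
  then show ?thesis by (simp add: complex_vec_slice)
qed

section \<open>Integration of radial functions\<close>

text \<open>
  The ball where \<open>norm y ^ n < a\<close> has volume proportional to \<open>a\<close>, so \<open>norm y ^ n\<close> distributes Lebesgue
  measure as a multiple of Lebesgue measure on the half-line.  This replaces polar coordinates.
\<close>

lemma distr_norm_power:
  "distr lborel borel (\<lambda>y::'a::euclidean_space. norm y ^ DIM('a))
     = density lborel (\<lambda>u. ennreal (unit_ball_vol (DIM('a))) * indicator {0..} u)" (is "?L = ?R")
proof -
  let ?n = "DIM('a)" and ?\<omega> = "unit_ball_vol (DIM('a))"
  have n: "0 < ?n" by simp
  have L: "emeasure ?L {..<a} = ennreal (?\<omega> * max 0 a)" for a
  proof -
    have "emeasure ?L {..<a} = emeasure lborel {y::'a. norm y ^ ?n < a}"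
      by (subst emeasure_distr) (auto simp: vimage_def)
    also have "{y::'a. norm y ^ ?n < a} = (if 0 < a then ball 0 (root ?n a) else {})"
    proof (cases "0 < a")
      case True
      have "norm y ^ ?n < a \<longleftrightarrow> norm y < root ?n a" for y :: 'a
        using real_root_less_iff[OF n, of "norm y ^ ?n" a] real_root_power_cancel[OF n, of "norm y"] by simp
      then have "{y::'a. norm y ^ ?n < a} = {y. norm y < root ?n a}"
        by (rule Collect_cong)
      also have "\<dots> = ball 0 (root ?n a)" by auto
      finally show ?thesis by (simp only: True if_True)
    next
      case False
      have "\<not> norm y ^ ?n < a" for y :: 'a
        using False zero_le_power[OF norm_ge_zero[of y], of ?n] by linarith
      then show ?thesis using False by simp
    qed
    also have "emeasure lborel \<dots> = ennreal (?\<omega> * max 0 a)"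
      using n by (auto simp: emeasure_ball max_def)
    finally show ?thesis .
  qed
  have R: "emeasure ?R {..<a} = ennreal (?\<omega> * max 0 a)" for a
  proof -
    have "emeasure ?R {..<a} = (\<integral>\<^sup>+u. ennreal ?\<omega> * indicator {0..<a} u \<partial>lborel)"
      by (subst emeasure_density) (auto intro!: nn_integral_cong simp: indicator_def)
    also have "\<dots> = ennreal ?\<omega> * emeasure lborel {0..<a}"
      by (rule nn_integral_cmult_indicator) simp
    also have "\<dots> = ennreal (?\<omega> * max 0 a)"
      by (cases "0 \<le> a") (auto simp: ennreal_mult max_def)
    finally show ?thesis .
  qed
  show ?thesis
  proof (rule measure_eqI_generator_eq[where E = "range lessThan" and \<Omega> = UNIV and A = "\<lambda>i. {..<real i}"])
    show "Int_stable (range (lessThan :: real \<Rightarrow> _))"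
    proof (rule Int_stableI_image)
      fix a b :: real
      show "\<exists>c\<in>UNIV. {..<a} \<inter> {..<b} = {..<c}" by (intro bexI[of _ "min a b"]) auto
    qed
    show "(\<Union>i. {..<real i}) = UNIV"
      using reals_Archimedean2 by auto
    show "emeasure ?L X = emeasure ?R X" if "X \<in> range lessThan" for X
      using that L R by auto
    show "sets ?L = sigma_sets UNIV (range lessThan)" "sets ?R = sigma_sets UNIV (range lessThan)"
      by (simp_all add: borel_Iio)
    show "range (\<lambda>i. {..<real i}) \<subseteq> range lessThan" by blast
    show "emeasure ?L {..<real i} \<noteq> \<infinity>" for i by (simp only: L) simp
  qed simp
qed

lemma nn_integral_radial:
  assumes [measurable]: "g \<in> borel_measurable borel"
  shows "(\<integral>\<^sup>+y. g (norm (y::'a::euclidean_space) ^ DIM('a)) \<partial>lborel)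
    = ennreal (unit_ball_vol (DIM('a))) * (\<integral>\<^sup>+u. g u * indicator {0..} u \<partial>lborel)"
proof -
  have "(\<integral>\<^sup>+y. g (norm (y::'a) ^ DIM('a)) \<partial>lborel) = (\<integral>\<^sup>+u. g u \<partial>distr lborel borel (\<lambda>y::'a. norm y ^ DIM('a)))"
    by (subst nn_integral_distr) auto
  also have "\<dots> = (\<integral>\<^sup>+u. ennreal (unit_ball_vol (DIM('a))) * (g u * indicator {0..} u) \<partial>lborel)"
    unfolding distr_norm_power by (subst nn_integral_density) (auto simp: mult_ac)
  also have "\<dots> = ennreal (unit_ball_vol (DIM('a))) * (\<integral>\<^sup>+u. g u * indicator {0..} u \<partial>lborel)"
    by (rule nn_integral_cmult) measurable
  finally show ?thesis .
qed

text \<open>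
  With \<open>u = norm y ^ n\<close> the bound \<open>M\<close> makes the integrand integrable at \<open>u = 0\<close> because \<open>\<kappa> > 1\<close>, and the
  bound \<open>A / u\<close> makes it integrable at infinity, where it becomes a multiple of \<open>u powr (-2)\<close>.  The result is
  linear in \<open>M\<close> whatever \<open>\<kappa>\<close> is, which is what an \<open>L\<^sup>2\<close> bound for the square root of \<open>M\<close> can absorb.
\<close>

proposition radial_integral_le:
  fixes H :: "'a::euclidean_space \<Rightarrow> real" and \<kappa> M A :: real
  assumes \<kappa>: "1 < \<kappa>" and M: "0 \<le> M" and A: "0 \<le> A"
    and H: "\<And>y. y \<in> B \<Longrightarrow> 0 \<le> H y" "\<And>y. y \<in> B \<Longrightarrow> H y \<le> M"
      "\<And>y. y \<in> B \<Longrightarrow> H y \<le> A / norm y ^ DIM('a)" and B: "0 \<notin> B"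
  shows "(\<integral>\<^sup>+y. ennreal (H y powr \<kappa> * (norm y ^ DIM('a)) powr (\<kappa> - 2)) * indicator B y \<partial>lborel)
    \<le> ennreal (unit_ball_vol (DIM('a)) * (1 / (\<kappa> - 1) + 1) * A powr (\<kappa> - 1) * M)"
proof (cases "M = 0 \<or> A = 0")
  case True
  then have "H y = 0" if "y \<in> B" for y
  proof -
    have "H y \<le> 0" using True H(2,3)[OF that] by auto
    then show ?thesis using H(1)[OF that] by simp
  qed
  then have "(\<integral>\<^sup>+y. ennreal (H y powr \<kappa> * (norm y ^ DIM('a)) powr (\<kappa> - 2)) * indicator B y \<partial>lborel)
      = (\<integral>\<^sup>+y. 0 \<partial>(lborel :: 'a measure))"
    by (intro nn_integral_cong) (auto simp: indicator_def)
  then show ?thesis by simp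
next
  case False
  then have pos: "0 < M" "0 < A" using M A by auto
  let ?n = "DIM('a)" and ?\<omega> = "unit_ball_vol (DIM('a))"
  \<comment> \<open>the two bounds for \<open>H\<close> cross at \<open>norm y ^ n = A / M\<close>\<close>
  define u0 where "u0 = A / M"
  have u0: "0 < u0" using pos by (simp add: u0_def)
  define g where "g u = ennreal (M powr \<kappa>) * (ennreal (u powr (\<kappa> - 2)) * indicator {0..u0} u)
      + ennreal (A powr \<kappa>) * (ennreal (u powr - 2) * indicator {u0..} u)" for u
  have g [measurable]: "g \<in> borel_measurable borel" unfolding g_def by measurable
  have le: "ennreal (H y powr \<kappa> * (norm y ^ ?n) powr (\<kappa> - 2)) * indicator B y \<le> g (norm y ^ ?n)" for y
  proof (cases "y \<in> B")
    case True
    then have "y \<noteq> 0" using B by auto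
    define u where "u = norm y ^ ?n"
    have u: "0 < u" using \<open>y \<noteq> 0\<close> by (simp add: u_def)
    show ?thesis
    proof (cases "u \<le> u0")
      case u_le: True
      have "H y powr \<kappa> * u powr (\<kappa> - 2) \<le> M powr \<kappa> * u powr (\<kappa> - 2)"
        using H[OF True] \<kappa> by (intro mult_right_mono powr_mono2) auto
      then have "ennreal (H y powr \<kappa> * u powr (\<kappa> - 2)) \<le> ennreal (M powr \<kappa>) * ennreal (u powr (\<kappa> - 2))"
        by (simp add: ennreal_leI flip: ennreal_mult)
      also have "\<dots> \<le> g u" using u u_le unfolding g_def by (intro add_increasing2) auto
      finally show ?thesis using True by (simp add: u_def)
    next
      case u_gt: False
      have "H y powr \<kappa> * u powr (\<kappa> - 2) \<le> (A / u) powr \<kappa> * u powr (\<kappa> - 2)"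
        using H[OF True] \<kappa> by (intro mult_right_mono powr_mono2) (auto simp: u_def)
      also have "\<dots> = A powr \<kappa> * u powr (- 2)"
      proof -
        have "(A / u) powr \<kappa> = A powr \<kappa> / u powr \<kappa>"
          using u pos by (simp add: powr_divide)
        moreover have "u powr (\<kappa> - 2) = u powr \<kappa> * u powr (- 2)"
          unfolding powr_add[symmetric] by simp
        ultimately show ?thesis using u by simp
      qed
      finally have "ennreal (H y powr \<kappa> * u powr (\<kappa> - 2)) \<le> ennreal (A powr \<kappa>) * ennreal (u powr - 2)"
        by (simp add: ennreal_leI flip: ennreal_mult)
      also have "\<dots> \<le> g u" using u_gt unfolding g_def by (intro add_increasing) auto
      finally show ?thesis using True by (simp add: u_def)
    qed
  qed simp
  have I1: "(\<integral>\<^sup>+u. ennreal (u powr (\<kappa> - 2)) * indicator {0..u0} u \<partial>lborel) = ennreal (u0 powr (\<kappa> - 1) / (\<kappa> - 1))"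
    using nn_integral_has_integral_lebesgue'[OF _ has_integral_powr_from_0[of "\<kappa> - 2" u0]] \<kappa> u0 by simp
  have I2: "(\<integral>\<^sup>+u. ennreal (u powr - 2) * indicator {u0..} u \<partial>lborel) = ennreal (1 / u0)"
  proof -
    have "u0 powr - 1 = 1 / u0" using u0 by (simp add: powr_minus_divide)
    then show ?thesis
      using nn_integral_has_integral_lebesgue'[OF _ has_integral_powr_to_inf[of "-2" u0]] u0 by simp
  qed
  have "(\<integral>\<^sup>+y. ennreal (H y powr \<kappa> * (norm y ^ ?n) powr (\<kappa> - 2)) * indicator B y \<partial>lborel)
      \<le> (\<integral>\<^sup>+y. g (norm (y::'a) ^ ?n) \<partial>lborel)"
    by (intro nn_integral_mono le)
  also have "\<dots> = ennreal ?\<omega> * (\<integral>\<^sup>+u. g u * indicator {0..} u \<partial>lborel)"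
    by (rule nn_integral_radial) measurable
  also have "\<dots> \<le> ennreal ?\<omega> * (\<integral>\<^sup>+u. g u \<partial>lborel)"
    by (intro mult_left_mono nn_integral_mono) (auto simp: indicator_def)
  also have "(\<integral>\<^sup>+u. g u \<partial>lborel) = ennreal (M powr \<kappa>) * ennreal (u0 powr (\<kappa> - 1) / (\<kappa> - 1)) + ennreal (A powr \<kappa>) * ennreal (1 / u0)"
    unfolding g_def by (subst nn_integral_add) (auto simp: nn_integral_cmult I1 I2)
  also have "\<dots> = ennreal (M powr \<kappa> * (u0 powr (\<kappa> - 1) / (\<kappa> - 1)) + A powr \<kappa> * (1 / u0))"
  proof -
    have "ennreal a * ennreal b + ennreal c * ennreal d = ennreal (a * b + c * d)"
      if "0 \<le> a" "0 \<le> b" "0 \<le> c" "0 \<le> d" for a b c d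
      using that by (simp add: ennreal_mult)
    then show ?thesis using \<kappa> u0 by simp
  qed
  also have "M powr \<kappa> * (u0 powr (\<kappa> - 1) / (\<kappa> - 1)) + A powr \<kappa> * (1 / u0) = (1 / (\<kappa> - 1) + 1) * A powr (\<kappa> - 1) * M"
  proof -
    have MA: "M powr \<kappa> = M powr (\<kappa> - 1) * M" "A powr \<kappa> = A powr (\<kappa> - 1) * A"
      using pos by (simp_all add: powr_diff)
    then show ?thesis
    proof -
      have *: "b * M * (a / b / k) + a * A * (1 / (A / M)) = (1 / k + 1) * a * M"
        if "0 < b" "0 < k" for a b k
        using that pos by (simp add: field_simps)
      have "u0 powr (\<kappa> - 1) = A powr (\<kappa> - 1) / M powr (\<kappa> - 1)"
        using pos by (simp add: u0_def powr_divide)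
      then show ?thesis
        using *[of "M powr (\<kappa> - 1)" "\<kappa> - 1" "A powr (\<kappa> - 1)"] pos \<kappa>
        unfolding u0_def MA by (simp only:) simp
    qed
  qed
  finally show ?thesis
    by (simp only: mult.assoc ennreal_mult'[OF unit_ball_vol_nonneg[OF of_nat_0_le_iff]])
qed


section \<open>Geometry of the Lorentz cone\<close>

lemma lorentz_det_eq:
  "lorentz_det e y = (y $ e)\<^sup>2 - (norm (y - (y $ e) *\<^sub>R axis e 1))\<^sup>2"
proof -
  have "(norm (y - (y $ e) *\<^sub>R axis e 1))\<^sup>2 = (\<Sum>j\<in>UNIV. ((y - (y $ e) *\<^sub>R axis e 1) $ j)\<^sup>2)"
    unfolding power2_norm_eq_inner inner_vec_def by (simp add: power2_eq_square)
  also have "\<dots> = (\<Sum>j\<in>UNIV - {e}. (y $ j)\<^sup>2)"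
    by (rule sum.mono_neutral_cong_right) (auto simp: axis_def)
  finally show ?thesis by (simp add: lorentz_det_def)
qed

lemma lorentz_cone_iff:
  "y \<in> lorentz_cone e \<longleftrightarrow> norm (y - (y $ e) *\<^sub>R axis e 1) < y $ e"
proof -
  have "a\<^sup>2 < b\<^sup>2 \<and> 0 < b \<longleftrightarrow> a < b" if "0 \<le> a" for a b :: real
    using that power2_less_imp_less[of a b] power_strict_mono[of a b 2] by auto
  then show ?thesis
    unfolding lorentz_cone_def lorentz_det_eq by auto
qed

lemma open_lorentz_cone: "open (lorentz_cone e)"
proof -
  have "lorentz_cone e = {y. norm (y - (y $ e) *\<^sub>R axis e 1) < y $ e}"
    by (auto simp: lorentz_cone_iff)
  then show ?thesis by (simp add: open_Collect_less continuous_intros)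
qed

lemma lorentz_cone_add:
  assumes "y \<in> lorentz_cone e" "v \<in> lorentz_cone e" "0 \<le> b"
  shows "y + b *\<^sub>R v \<in> lorentz_cone e"
proof -
  have eq: "(y + b *\<^sub>R v) - ((y + b *\<^sub>R v) $ e) *\<^sub>R axis e 1
      = (y - (y $ e) *\<^sub>R axis e 1) + b *\<^sub>R (v - (v $ e) *\<^sub>R axis e 1)"
    by (simp add: algebra_simps)
  have "norm ((y + b *\<^sub>R v) - ((y + b *\<^sub>R v) $ e) *\<^sub>R axis e 1)
      \<le> norm (y - (y $ e) *\<^sub>R axis e 1) + norm (b *\<^sub>R (v - (v $ e) *\<^sub>R axis e 1))"
    unfolding eq by (rule norm_triangle_ineq)
  also have "\<dots> = norm (y - (y $ e) *\<^sub>R axis e 1) + b * norm (v - (v $ e) *\<^sub>R axis e 1)"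
    using assms(3) by simp
  also have "\<dots> < y $ e + b * (v $ e)"
    using assms by (intro add_less_le_mono mult_left_mono) (auto simp: lorentz_cone_iff)
  finally show ?thesis by (simp add: lorentz_cone_iff)
qed

lemma axis_in_lorentz_cone: "0 < b \<Longrightarrow> b *\<^sub>R axis e 1 \<in> lorentz_cone e"
  by (simp add: lorentz_cone_iff)

lemma zero_notin_lorentz_cone: "0 \<notin> lorentz_cone e"
  by (simp add: lorentz_cone_iff)

text \<open>
  The points at distance at least \<open>c * norm y\<close> from the complement of the cone.  A restricted region lies in
  such a set, which in addition is a Borel set.
\<close>

definition cone_core :: "'n::finite \<Rightarrow> real \<Rightarrow> (real ^ 'n) set" where
  "cone_core e c = {y \<in> lorentz_cone e. ball y (c * norm y) \<subseteq> lorentz_cone e}"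

lemma cone_core_borel: "cone_core e c \<in> sets borel"
proof -
  have "cone_core e c = lorentz_cone e \<inter> (\<Inter>z\<in>- lorentz_cone e. {y. c * norm y \<le> dist y z})"
    unfolding cone_core_def by (force simp: subset_iff not_le)
  moreover have "closed (\<Inter>z\<in>- lorentz_cone e. {y. c * norm y \<le> dist y z})"
    by (intro closed_INT ballI closed_Collect_le continuous_intros)
  ultimately show ?thesis
    using borel_open[OF open_lorentz_cone[of e]] borel_closed by (auto intro: sets.Int)
qed

text \<open>
  A ball around a point of the cone that avoids the boundary of the cone stays inside by connectedness.
\<close>

lemma restricted_region_subset_core:
  assumes "restricted_region e B"
  obtains c where "0 < c" "c \<le> 1" "B \<subseteq> cone_core e c"
proof -
  obtain K where K: "0 < K" "\<And>y. y \<in> B \<Longrightarrow> norm y < K * infdist y (frontier (lorentz_cone e))"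
    and B: "B \<subseteq> lorentz_cone e"
    using assms unfolding restricted_region_def by (auto simp: dist_norm)
  have "y \<in> cone_core e (1 / (K + 1))" if y: "y \<in> B" for y
  proof -
    let ?d = "infdist y (frontier (lorentz_cone e))"
    have d: "0 \<le> ?d" by (rule infdist_nonneg)
    have "norm y < (K + 1) * ?d"
      using K(2)[OF y] d by (simp add: algebra_simps)
    then have le: "1 / (K + 1) * norm y \<le> ?d"
      using K(1) by (simp add: field_simps)
    have yL: "y \<in> lorentz_cone e" using B y by auto
    have "ball y ?d \<inter> frontier (lorentz_cone e) = {}"
    proof -
      have False if "z \<in> ball y ?d" "z \<in> frontier (lorentz_cone e)" for z
        using infdist_le[OF that(2), of y] that(1) by simp
      then show ?thesis by blast
    qed
    then have "ball y ?d \<subseteq> lorentz_cone e"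
    proof (cases "?d = 0")
      case False
      with d have "y \<in> ball y ?d" by simp
      with yL have "ball y ?d \<inter> lorentz_cone e \<noteq> {}" by blast
      then show ?thesis
        using connected_Int_frontier[of "ball y ?d" "lorentz_cone e"] \<open>ball y ?d \<inter> frontier (lorentz_cone e) = {}\<close>
        by auto
    qed simp
    then show ?thesis
      using yL le unfolding cone_core_def by (auto simp: subset_iff)
  qed
  then show ?thesis
    using K(1) by (intro that[of "1 / (K + 1)"]) auto
qed

text \<open>
  The determinant is the product of \<open>y $ e - s\<close> and \<open>y $ e + s\<close>, where \<open>s\<close> is the norm of the space-like
  part.  Moving \<open>y\<close> down the axis by \<open>y $ e - s\<close> reaches the boundary, so the first factor is at least
  \<open>c * norm y\<close>; the second is at least \<open>norm y\<close> by the triangle inequality.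
\<close>

lemma lorentz_det_core_bounds:
  assumes y: "y \<in> cone_core e c" and c: "0 < c"
  shows "c * (norm y)\<^sup>2 \<le> lorentz_det e y" "lorentz_det e y \<le> (norm y)\<^sup>2"
proof -
  let ?s = "norm (y - (y $ e) *\<^sub>R axis e 1)" and ?r = "norm y"
  have yL: "?s < y $ e" and ball: "ball y (c * ?r) \<subseteq> lorentz_cone e"
    using y by (auto simp: cone_core_def lorentz_cone_iff)
  have s0: "0 \<le> ?s" by simp
  have "?r \<le> \<bar>y $ e\<bar> + ?s"
    using norm_triangle_ineq[of "(y $ e) *\<^sub>R axis e 1" "y - (y $ e) *\<^sub>R axis e 1"] by simp
  then have r: "?r \<le> y $ e + ?s" using yL s0 by simp
  have "c * ?r \<le> y $ e - ?s"
  proof (rule ccontr)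
    assume "\<not> c * ?r \<le> y $ e - ?s"
    then have lt: "y $ e - ?s < c * ?r" by simp
    define t where "t = y $ e - ?s"
    have "y - t *\<^sub>R axis e 1 \<in> ball y (c * ?r)"
      using lt yL by (simp add: t_def dist_norm)
    then have "y - t *\<^sub>R axis e 1 \<in> lorentz_cone e" using ball by blast
    then have "?s < y $ e - t"
      by (simp add: lorentz_cone_iff algebra_simps)
    then show False by (simp add: t_def)
  qed
  then have "(c * ?r) * ?r \<le> (y $ e - ?s) * (y $ e + ?s)"
    using r c yL s0 by (intro mult_mono) auto
  then show "c * (norm y)\<^sup>2 \<le> lorentz_det e y"
    unfolding lorentz_det_eq by (simp add: power2_eq_square algebra_simps)
  have "(y $ e)\<^sup>2 \<le> (norm y)\<^sup>2"
    using component_le_norm_cart[of y e] order_le_less_trans[OF s0 yL] by (intro power_mono) auto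
  then show "lorentz_det e y \<le> (norm y)\<^sup>2"
    unfolding lorentz_det_eq using zero_le_power2[of ?s] by linarith
qed

text \<open>
  The exponent may have either sign: the upper bound on the determinant is used for a nonnegative exponent,
  the lower bound for a negative one.  The absolute value in the constant covers both cases.
\<close>

lemma lorentz_det_powr_core:
  fixes y :: "real ^ 'n::finite"
  assumes y: "y \<in> cone_core e c" and c: "0 < c" "c \<le> 1"
  shows "lorentz_det e y powr (CARD('n) / 2 * \<beta>) \<le> c powr - \<bar>CARD('n) / 2 * \<beta>\<bar> * (norm y ^ CARD('n)) powr \<beta>"
proof -
  let ?a = "CARD('n) / 2 * \<beta>" and ?r = "norm y"
  have "y \<noteq> 0" using y zero_notin_lorentz_cone[of e] by (auto simp: cone_core_def)
  then have r: "0 < ?r" by simp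
  have eq: "(?r\<^sup>2) powr ?a = (?r ^ CARD('n)) powr \<beta>"
  proof -
    have "?r\<^sup>2 = ?r powr 2" "?r ^ CARD('n) = ?r powr real CARD('n)"
      using r powr_realpow[OF r, of 2] by (simp_all add: powr_realpow)
    then show ?thesis by (simp only: powr_powr) simp
  qed
  note b = lorentz_det_core_bounds[OF y c(1)]
  have one: "1 \<le> c powr - \<bar>?a\<bar>"
    using powr_mono'[of "- \<bar>?a\<bar>" 0 c] c by simp
  show ?thesis
  proof (cases "0 \<le> ?a")
    case True
    have "0 \<le> lorentz_det e y" using b(1) c mult_nonneg_nonneg[of c "?r\<^sup>2"] by (meson less_imp_le order_trans zero_le_power2)
    then have "lorentz_det e y powr ?a \<le> (?r\<^sup>2) powr ?a"
      using b True by (intro powr_mono2) auto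
    also have "\<dots> \<le> c powr - \<bar>?a\<bar> * (?r\<^sup>2) powr ?a"
      using one by (simp add: mult_le_cancel_right1)
    finally show ?thesis by (simp only: eq)
  next
    case False
    have "lorentz_det e y powr ?a \<le> (c * ?r\<^sup>2) powr ?a"
      using b False c r by (intro powr_mono2') auto
    also have "\<dots> = c powr - \<bar>?a\<bar> * (?r\<^sup>2) powr ?a"
      using False c r by (simp add: powr_mult)
    finally show ?thesis by (simp only: eq)
  qed
qed

section \<open>Decay in the height and domination by the maximal function\<close>

lemma nn_integral_lborel_affine:
  fixes g :: "'a::euclidean_space \<Rightarrow> ennreal"
  assumes [measurable]: "g \<in> borel_measurable borel" and c: "c \<noteq> 0"
  shows "(\<integral>\<^sup>+x. g x \<partial>lborel) = ennreal (\<bar>c\<bar> ^ DIM('a)) * (\<integral>\<^sup>+x. g (t + c *\<^sub>R x) \<partial>lborel)"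
  by (subst lborel_affine[OF c, of t])
     (simp add: nn_integral_density nn_integral_distr nn_integral_cmult)

lemma powr_borel_tube:
  assumes F: "holomorphic_vec_on F (tube S)" and S: "open S" and s: "0 < s"
  shows "(\<lambda>p. ennreal (cmod (F (complex_vec (fst p) (snd p))) powr s) * indicator (UNIV \<times> S) p) \<in> borel_measurable borel"
proof -
  have "continuous_on (UNIV \<times> S) (\<lambda>p. cmod (F (complex_vec (fst p) (snd p))) powr s)"
    using s by (intro continuous_on_powr' continuous_intros holomorphic_vec_continuous_on[OF F]) auto
  then have "(\<lambda>p. indicator (UNIV \<times> S) p *\<^sub>R cmod (F (complex_vec (fst p) (snd p))) powr s) \<in> borel_measurable borel"
    using S by (intro borel_measurable_continuous_on_indicator borel_open open_Times) auto
  then have "(\<lambda>p. ennreal (indicator (UNIV \<times> S) p *\<^sub>R cmod (F (complex_vec (fst p) (snd p))) powr s)) \<in> borel_measurable borel"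
    by measurable
  moreover have "(\<lambda>p. ennreal (indicator (UNIV \<times> S) p *\<^sub>R cmod (F (complex_vec (fst p) (snd p))) powr s))
      = (\<lambda>p. ennreal (cmod (F (complex_vec (fst p) (snd p))) powr s) * indicator (UNIV \<times> S) p)"
    by (auto simp: fun_eq_iff indicator_def)
  ultimately show ?thesis by (simp only:)
qed

lemma powr_borel_level:
  assumes F: "holomorphic_vec_on F (tube S)" and y: "y \<in> S" and s: "0 < s"
  shows "(\<lambda>x. ennreal (cmod (F (complex_vec x y)) powr s)) \<in> borel_measurable borel"
proof -
  have "continuous_on UNIV (\<lambda>x. F (complex_vec (fst (x, y)) (snd (x, y))))"
    by (rule continuous_on_compose2[OF holomorphic_vec_continuous_on[OF F], of UNIV "\<lambda>x. (x, y)"])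
       (use y in \<open>auto intro!: continuous_intros\<close>)
  then have "continuous_on UNIV (\<lambda>x. cmod (F (complex_vec x y)) powr s)"
    using s by (intro continuous_on_powr' continuous_intros) auto
  then show ?thesis
    by (intro measurable_compose[OF borel_measurable_continuous_onI measurable_ennreal])
qed

text \<open>
  The ball in the product is replaced by the larger product of balls, over which integrals can be iterated.
\<close>

lemma power_submean_product:
  fixes F :: "complex ^ 'n::finite \<Rightarrow> complex"
  assumes F: "holomorphic_vec_on F (tube S)" and S: "open S" and sub: "ball y \<rho> \<subseteq> S" and s: "0 < s"
  shows "ennreal (cmod (F (complex_vec x y)) powr s) * emeasure lborel (ball (x, y) \<rho>)
    \<le> (\<integral>\<^sup>+x'. \<integral>\<^sup>+y'. ennreal (cmod (F (complex_vec x' y')) powr s) * (indicator (ball x \<rho>) x' * indicator (ball y \<rho>) y') \<partial>lborel \<partial>lborel)"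
    (is "?L \<le> ?R")
    and "(\<lambda>(x', y'). ennreal (cmod (F (complex_vec x' y')) powr s) * (indicator (ball x \<rho>) x' * indicator (ball y \<rho>) y'))
      \<in> borel_measurable (lborel \<Otimes>\<^sub>M lborel)"
proof -
  let ?\<Phi> = "\<lambda>p. ennreal (cmod (F (complex_vec (fst p) (snd p))) powr s)"
  let ?b = "\<lambda>p. indicator (ball x \<rho>) (fst p) * indicator (ball y \<rho>) (snd p) :: ennreal"
  have [measurable]: "(\<lambda>p. ?\<Phi> p * indicator (UNIV \<times> S) p) \<in> borel_measurable (borel \<Otimes>\<^sub>M borel)"
    using powr_borel_tube[OF F S s] by (simp only: borel_prod)
  have [measurable]: "ball x \<rho> \<in> sets borel" "ball y \<rho> \<in> sets borel" by simp_all
  have "(\<lambda>p. ?\<Phi> p * indicator (UNIV \<times> S) p * ?b p) \<in> borel_measurable (borel \<Otimes>\<^sub>M borel)"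
    by measurable
  moreover have "(\<lambda>p. ?\<Phi> p * indicator (UNIV \<times> S) p * ?b p) = (\<lambda>p. ?\<Phi> p * ?b p)"
    using sub by (auto simp: fun_eq_iff indicator_def)
  ultimately have meas: "(\<lambda>p. ?\<Phi> p * ?b p) \<in> borel_measurable (lborel \<Otimes>\<^sub>M lborel)"
    by (simp only: measurable_lborel1 measurable_cong_sets[OF sets_pair_measure_cong[OF sets_lborel sets_lborel] refl])
  then show "(\<lambda>(x', y'). ennreal (cmod (F (complex_vec x' y')) powr s) * (indicator (ball x \<rho>) x' * indicator (ball y \<rho>) y'))
      \<in> borel_measurable (lborel \<Otimes>\<^sub>M lborel)"
    by (simp only: split_beta')
  have "?L \<le> (\<integral>\<^sup>+p. ?\<Phi> p * indicator (ball (x, y) \<rho>) p \<partial>lborel)"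
    by (rule power_submean_ball[OF F sub s])
  also have "\<dots> \<le> (\<integral>\<^sup>+p. ?\<Phi> p * ?b p \<partial>lborel)"
  proof (intro nn_integral_mono mult_left_mono)
    fix p
    show "indicator (ball (x, y) \<rho>) p \<le> ?b p"
      using dist_fst_le[of "(x, y)" p] dist_snd_le[of "(x, y)" p] by (auto simp: indicator_def)
  qed simp
  also have "\<dots> = (\<integral>\<^sup>+p. ?\<Phi> p * ?b p \<partial>(lborel \<Otimes>\<^sub>M lborel))"
    by (simp only: lborel_prod)
  also have "\<dots> = ?R"
    using lborel.nn_integral_fst[OF meas] by simp
  finally show "?L \<le> ?R" .
qed

lemma pointwise_bound:
  fixes F :: "complex ^ 'n::finite \<Rightarrow> complex"
  assumes F: "holomorphic_vec_on F (tube S)" and S: "open S" and sub: "ball y \<rho> \<subseteq> S" and s: "0 < s"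
    and N: "\<And>t. t \<in> S \<Longrightarrow> (\<integral>\<^sup>+x. ennreal (cmod (F (complex_vec x t)) powr s) \<partial>lborel) \<le> N"
  shows "ennreal (cmod (F (complex_vec x y)) powr s) * emeasure lborel (ball (x, y) \<rho>)
    \<le> emeasure lborel (ball y \<rho>) * N"
proof -
  note * = power_submean_product[OF assms(1-4), of x]
  have "ennreal (cmod (F (complex_vec x y)) powr s) * emeasure lborel (ball (x, y) \<rho>)
    \<le> (\<integral>\<^sup>+y'. \<integral>\<^sup>+x'. ennreal (cmod (F (complex_vec x' y')) powr s) * (indicator (ball x \<rho>) x' * indicator (ball y \<rho>) y') \<partial>lborel \<partial>lborel)"
    using *(1) lborel_pair.Fubini'[OF *(2)] by simp
  also have "\<dots> \<le> (\<integral>\<^sup>+y'. N * indicator (ball y \<rho>) y' \<partial>lborel)"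
  proof (rule nn_integral_mono)
    fix y'
    show "(\<integral>\<^sup>+x'. ennreal (cmod (F (complex_vec x' y')) powr s) * (indicator (ball x \<rho>) x' * indicator (ball y \<rho>) y') \<partial>lborel)
        \<le> N * indicator (ball y \<rho>) y'"
    proof (cases "y' \<in> ball y \<rho>")
      case True
      have "(\<integral>\<^sup>+x'. ennreal (cmod (F (complex_vec x' y')) powr s) * (indicator (ball x \<rho>) x' * indicator (ball y \<rho>) y') \<partial>lborel)
          \<le> (\<integral>\<^sup>+x'. ennreal (cmod (F (complex_vec x' y')) powr s) \<partial>lborel)"
        by (intro nn_integral_mono) (auto simp: indicator_def)
      also have "\<dots> \<le> N" using True sub by (intro N) auto
      finally show ?thesis using True by simp
    qed simp
  qed
  also have "\<dots> = N * emeasure lborel (ball y \<rho>)"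
    by (rule nn_integral_cmult_indicator) simp
  finally show ?thesis by (simp only: mult.commute)
qed

text \<open>
  Put \<open>r = norm y\<close>.  If \<open>|t| \<le> 1\<close>, then \<open>x' + t y'\<close> stays within distance \<open>3 * r\<close> of \<open>x\<close>, and integration
  over \<open>x'\<close> is integration over a subset of that ball.  If \<open>|t| \<ge> 1\<close>, it stays within distance
  \<open>3 * |t| * r\<close>, and substituting \<open>w = x' + t y'\<close> in the integral over \<open>y'\<close> gives a factor \<open>|t| ^ (-n)\<close> that
  compensates the volume of the larger ball.  A further factor \<open>2\<close> in the radius comes from the rational
  radii in the maximal function.
\<close>

lemma average_le_maximal:
  fixes f :: "'a::euclidean_space \<Rightarrow> ennreal"
  assumes f: "f \<in> borel_measurable borel" and \<rho>: "0 < \<rho>" "\<rho> \<le> norm y"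
  shows "(\<integral>\<^sup>+x'. \<integral>\<^sup>+y'. f (x' + t *\<^sub>R y') * (indicator (ball x \<rho>) x' * indicator (ball y \<rho>) y') \<partial>lborel \<partial>lborel)
    \<le> emeasure lborel (ball (0::'a) \<rho>) * (emeasure lborel (ball (0::'a) (6 * norm y)) * maximal_function f x)"
    (is "?L \<le> ?v * ?W")
proof -
  define r where "r = norm y"
  have r: "0 < r" using \<rho> unfolding r_def by linarith
  note f [measurable]
  have near: "norm (x' + t *\<^sub>R y' - x) < \<rho> + \<bar>t\<bar> * (r + \<rho>)" if "x' \<in> ball x \<rho>" "y' \<in> ball y \<rho>" for x' y'
  proof -
    have "norm y' \<le> r + \<rho>"
      using norm_triangle_ineq2[of y' y] that(2) by (simp add: r_def dist_norm norm_minus_commute)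
    have "norm (x' + t *\<^sub>R y' - x) \<le> norm (x' - x) + norm (t *\<^sub>R y')"
      using norm_triangle_ineq[of "x' - x" "t *\<^sub>R y'"] by (simp add: algebra_simps)
    also have "\<dots> < \<rho> + \<bar>t\<bar> * (r + \<rho>)"
      using that(1) \<open>norm y' \<le> r + \<rho>\<close>
      by (intro add_less_le_mono) (auto simp: dist_norm norm_minus_commute intro: mult_left_mono)
    finally show ?thesis .
  qed
  have small: "\<rho> + \<bar>t\<bar> * (r + \<rho>) \<le> 3 * (R * r)" if "1 \<le> R" "\<bar>t\<bar> \<le> R" for R
  proof -
    have "\<bar>t\<bar> * (r + \<rho>) \<le> R * (r + r)"
      using that \<rho> r by (intro mult_mono) (auto simp: r_def)
    moreover have "\<rho> \<le> R * r"
      using mult_mono[of 1 R \<rho> r] that \<rho> r by (simp add: r_def)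
    ultimately show ?thesis by (simp add: algebra_simps)
  qed
  show ?thesis
  proof (cases "\<bar>t\<bar> \<le> 1")
    case True
    let ?g = "\<lambda>w. f w * indicator (ball x (3 * r)) w"
    have [measurable]: "ball x \<rho> \<in> sets borel" "ball y \<rho> \<in> sets borel" "ball x (3 * r) \<in> sets borel" by simp_all
    have "?L = (\<integral>\<^sup>+y'. \<integral>\<^sup>+x'. f (x' + t *\<^sub>R y') * (indicator (ball x \<rho>) x' * indicator (ball y \<rho>) y') \<partial>lborel \<partial>lborel)"
      by (rule lborel_pair.Fubini'[symmetric]) measurable
    also have "\<dots> \<le> (\<integral>\<^sup>+y'. ?W * indicator (ball y \<rho>) y' \<partial>lborel)"
    proof (rule nn_integral_mono)
      fix y'
      have "(\<integral>\<^sup>+x'. f (x' + t *\<^sub>R y') * (indicator (ball x \<rho>) x' * indicator (ball y \<rho>) y') \<partial>lborel)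
          \<le> (\<integral>\<^sup>+x'. ?g (x' + t *\<^sub>R y') * indicator (ball y \<rho>) y' \<partial>lborel)"
      proof (rule nn_integral_mono)
        fix x'
        have "x' + t *\<^sub>R y' \<in> ball x (3 * r)" if "x' \<in> ball x \<rho>" "y' \<in> ball y \<rho>"
          using near[OF that] small[of 1] True by (simp add: dist_norm norm_minus_commute)
        then show "f (x' + t *\<^sub>R y') * (indicator (ball x \<rho>) x' * indicator (ball y \<rho>) y')
            \<le> ?g (x' + t *\<^sub>R y') * indicator (ball y \<rho>) y'"
          by (auto simp: indicator_def)
      qed
      also have "\<dots> = (\<integral>\<^sup>+x'. ?g (x' + t *\<^sub>R y') \<partial>lborel) * indicator (ball y \<rho>) y'"
        by (rule nn_integral_multc) measurable
      also have "(\<integral>\<^sup>+x'. ?g (x' + t *\<^sub>R y') \<partial>lborel) = (\<integral>\<^sup>+w. ?g w \<partial>lborel)"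
        by (rule nn_integral_lborel_translate) measurable
      also have "\<dots> \<le> ?W"
        using nn_integral_ball_le_maximal[of "3 * r" "ball x (3 * r)" x f] r
        by (simp add: r_def emeasure_lborel_ball_center[of x])
      finally show "(\<integral>\<^sup>+x'. f (x' + t *\<^sub>R y') * (indicator (ball x \<rho>) x' * indicator (ball y \<rho>) y') \<partial>lborel)
          \<le> ?W * indicator (ball y \<rho>) y'"
        by (simp add: mult_right_mono)
    qed
    also have "\<dots> = ?W * emeasure lborel (ball y \<rho>)"
      by (rule nn_integral_cmult_indicator) simp
    finally show ?thesis
      by (simp only: mult.commute emeasure_lborel_ball_center[of y])
  next
    case False
    then have t: "t \<noteq> 0" "1 \<le> \<bar>t\<bar>" by auto
    let ?R = "\<bar>t\<bar> * r"
    let ?g = "\<lambda>w. f w * indicator (ball x (3 * ?R)) w"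
    have [measurable]: "ball x (3 * ?R) \<in> sets borel" by simp
    have "?L \<le> (\<integral>\<^sup>+x'. ?W * indicator (ball x \<rho>) x' \<partial>lborel)"
    proof (rule nn_integral_mono)
      fix x'
      have meas: "(\<lambda>y'. ?g (x' + t *\<^sub>R y')) \<in> borel_measurable borel" by measurable
      have "(\<integral>\<^sup>+y'. f (x' + t *\<^sub>R y') * (indicator (ball x \<rho>) x' * indicator (ball y \<rho>) y') \<partial>lborel)
          \<le> (\<integral>\<^sup>+y'. ?g (x' + t *\<^sub>R y') * indicator (ball x \<rho>) x' \<partial>lborel)"
      proof (rule nn_integral_mono)
        fix y'
        have "x' + t *\<^sub>R y' \<in> ball x (3 * ?R)" if "x' \<in> ball x \<rho>" "y' \<in> ball y \<rho>"
          using near[OF that] small[OF t(2)] by (simp add: dist_norm norm_minus_commute)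
        then show "f (x' + t *\<^sub>R y') * (indicator (ball x \<rho>) x' * indicator (ball y \<rho>) y')
            \<le> ?g (x' + t *\<^sub>R y') * indicator (ball x \<rho>) x'"
          by (auto simp: indicator_def)
      qed
      also have "\<dots> = (\<integral>\<^sup>+y'. ?g (x' + t *\<^sub>R y') \<partial>lborel) * indicator (ball x \<rho>) x'"
        using meas by (intro nn_integral_multc) simp
      also have "(\<integral>\<^sup>+y'. ?g (x' + t *\<^sub>R y') \<partial>lborel) \<le> ?W"
      proof -
        let ?c = "ennreal (\<bar>t\<bar> ^ DIM('a))"
        have "?c * (\<integral>\<^sup>+y'. ?g (x' + t *\<^sub>R y') \<partial>lborel) = (\<integral>\<^sup>+w. ?g w \<partial>lborel)"
          by (rule nn_integral_lborel_affine[symmetric]) (use t in measurable)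
        also have "\<dots> \<le> emeasure lborel (ball x (2 * (3 * ?R))) * maximal_function f x"
          using r t by (intro nn_integral_ball_le_maximal) auto
        also have "2 * (3 * ?R) = \<bar>t\<bar> * (6 * r)" by simp
        also have "emeasure lborel (ball x (\<bar>t\<bar> * (6 * r))) = ?c * emeasure lborel (ball (0::'a) (6 * r))"
          using r by (intro emeasure_ball_scale) auto
        finally have "?c * (\<integral>\<^sup>+y'. ?g (x' + t *\<^sub>R y') \<partial>lborel) \<le> ?c * ?W"
          by (simp only: mult.assoc r_def)
        moreover have "?c \<noteq> 0" "?c \<noteq> top" using t by auto
        ultimately show ?thesis
          using ennreal_mult_le_mult_iff[of ?c] by blast
      qed
      finally show "(\<integral>\<^sup>+y'. f (x' + t *\<^sub>R y') * (indicator (ball x \<rho>) x' * indicator (ball y \<rho>) y') \<partial>lborel)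
          \<le> ?W * indicator (ball x \<rho>) x'"
        by (simp add: mult_right_mono)
    qed
    also have "\<dots> = ?W * emeasure lborel (ball x \<rho>)"
      by (rule nn_integral_cmult_indicator) simp
    finally show ?thesis
      by (simp only: mult.commute emeasure_lborel_ball_center[of x])
  qed
qed

text \<open>
  For \<open>y'\<close> near \<open>y\<close> the ray through \<open>y'\<close> leads from height \<open>0\<close> to height \<open>y'\<close>, so the half-plane inequality
  starts directly from the values of \<open>F\<close> on the real space.
\<close>

proposition power_le_maximal:
  fixes F :: "complex ^ 'n::finite \<Rightarrow> complex"
  assumes F: "holomorphic_vec_on F (tube S)" and S: "open S" "0 \<in> S" and s: "0 < s"
    and ball: "ball y \<rho> \<subseteq> S" and \<rho>: "0 < \<rho>" "\<rho> \<le> norm y"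
    and ray: "\<And>v b. v \<in> ball y \<rho> \<Longrightarrow> 0 \<le> b \<Longrightarrow> b *\<^sub>R v \<in> S"
    and bdd: "\<And>v b x. v \<in> ball y \<rho> \<Longrightarrow> 0 \<le> b \<Longrightarrow> cmod (F (complex_vec x (b *\<^sub>R v))) \<le> K"
  shows "ennreal (cmod (F (complex_vec x y)) powr s) * emeasure lborel (ball (x, y) \<rho>)
    \<le> emeasure lborel (ball (0 :: real ^ 'n) \<rho>) * (emeasure lborel (ball (0 :: real ^ 'n) (6 * norm y))
        * maximal_function (\<lambda>u. ennreal (cmod (F (complex_vec u 0)) powr s)) x)"
    (is "?L \<le> ?R")
proof -
  define f where "f u = ennreal (cmod (F (complex_vec u 0)) powr s)" for u
  have f [measurable]: "f \<in> borel_measurable borel"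
    unfolding f_def by (rule powr_borel_level[OF F S(2) s])
  let ?b = "\<lambda>x' y'. indicator (ball x \<rho>) x' * indicator (ball y \<rho>) y' :: ennreal"
  have [measurable]: "ball x \<rho> \<in> sets borel" "ball y \<rho> \<in> sets borel" by simp_all
  have "?L \<le> (\<integral>\<^sup>+x'. \<integral>\<^sup>+y'. ennreal (cmod (F (complex_vec x' y')) powr s) * ?b x' y' \<partial>lborel \<partial>lborel)"
    by (rule power_submean_product(1)[OF F S(1) ball s])
  also have "\<dots> \<le> (\<integral>\<^sup>+x'. \<integral>\<^sup>+y'. \<integral>\<^sup>+t. f (x' + t *\<^sub>R y') * ?b x' y' \<partial>cauchy_measure \<partial>lborel \<partial>lborel)"
  proof (intro nn_integral_mono)
    fix x' y'
    show "ennreal (cmod (F (complex_vec x' y')) powr s) * ?b x' y' \<le> (\<integral>\<^sup>+t. f (x' + t *\<^sub>R y') * ?b x' y' \<partial>cauchy_measure)"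
    proof (cases "y' \<in> ball y \<rho>")
      case True
      have "ennreal (cmod (F (complex_vec x' (0 + y'))) powr s)
          \<le> (\<integral>\<^sup>+t. ennreal (cmod (F (complex_vec (x' + t *\<^sub>R y') 0)) powr s) \<partial>cauchy_measure)"
        by (rule power_submean_tube[OF F s, where K = K]) (use ray[OF True] bdd[OF True] in auto)
      then have "ennreal (cmod (F (complex_vec x' y')) powr s) * ?b x' y'
          \<le> (\<integral>\<^sup>+t. f (x' + t *\<^sub>R y') \<partial>cauchy_measure) * ?b x' y'"
        by (intro mult_right_mono) (simp_all add: f_def)
      also have "\<dots> = (\<integral>\<^sup>+t. f (x' + t *\<^sub>R y') * ?b x' y' \<partial>cauchy_measure)"
        by (rule nn_integral_multc[symmetric]) measurable
      finally show ?thesis .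
    qed simp
  qed
  also have "\<dots> = (\<integral>\<^sup>+t. \<integral>\<^sup>+x'. \<integral>\<^sup>+y'. f (x' + t *\<^sub>R y') * ?b x' y' \<partial>lborel \<partial>lborel \<partial>cauchy_measure)"
  proof -
    interpret P: pair_sigma_finite cauchy_measure "lborel :: (real ^ 'n) measure" ..
    have "(\<integral>\<^sup>+y'. \<integral>\<^sup>+t. f (x' + t *\<^sub>R y') * ?b x' y' \<partial>cauchy_measure \<partial>lborel)
        = (\<integral>\<^sup>+t. \<integral>\<^sup>+y'. f (x' + t *\<^sub>R y') * ?b x' y' \<partial>lborel \<partial>cauchy_measure)" for x'
      by (rule P.Fubini') measurable
    then have "(\<integral>\<^sup>+x'. \<integral>\<^sup>+y'. \<integral>\<^sup>+t. f (x' + t *\<^sub>R y') * ?b x' y' \<partial>cauchy_measure \<partial>lborel \<partial>lborel)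
        = (\<integral>\<^sup>+x'. \<integral>\<^sup>+t. \<integral>\<^sup>+y'. f (x' + t *\<^sub>R y') * ?b x' y' \<partial>lborel \<partial>cauchy_measure \<partial>lborel)"
      by simp
    also have "\<dots> = (\<integral>\<^sup>+t. \<integral>\<^sup>+x'. \<integral>\<^sup>+y'. f (x' + t *\<^sub>R y') * ?b x' y' \<partial>lborel \<partial>lborel \<partial>cauchy_measure)"
      by (rule P.Fubini') measurable
    finally show ?thesis .
  qed
  also have "\<dots> \<le> (\<integral>\<^sup>+t. ?R \<partial>cauchy_measure)"
    unfolding f_def[abs_def, symmetric]
    by (intro nn_integral_mono average_le_maximal[OF f \<rho>])
  also have "\<dots> = ?R"
    by (simp add: emeasure_cauchy_measure)
  finally show ?thesis .
qed

section \<open>The weighted estimate on a restricted region\<close>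

lemma lorentz_cone_scale:
  assumes "v \<in> lorentz_cone e" "0 < b"
  shows "b *\<^sub>R v \<in> lorentz_cone e"
proof -
  have "b *\<^sub>R v - ((b *\<^sub>R v) $ e) *\<^sub>R axis e 1 = b *\<^sub>R (v - (v $ e) *\<^sub>R axis e 1)"
    by (simp add: algebra_simps)
  then have "norm (b *\<^sub>R v - ((b *\<^sub>R v) $ e) *\<^sub>R axis e 1) = b * norm (v - (v $ e) *\<^sub>R axis e 1)"
    using assms(2) by (simp only: norm_scaleR abs_of_pos)
  then show ?thesis
    using assms by (simp add: lorentz_cone_iff)
qed

lemma borel_measurable_lorentz_det [measurable]: "lorentz_det e \<in> borel_measurable borel"
  unfolding lorentz_det_def by (intro borel_measurable_continuous_onI continuous_intros)

lemma core_integrand_borel: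
  fixes F :: "complex ^ 'n::finite \<Rightarrow> complex"
  assumes F: "holomorphic_vec_on F (tube S)" and S: "open S" "lorentz_cone e \<subseteq> S" and q: "0 < q"
    and w: "w \<in> borel_measurable borel"
  shows "(\<lambda>p. ennreal (cmod (F (complex_vec (fst p) (snd p))) powr q * w (snd p))
      * indicator (cone_core e c) (snd p)) \<in> borel_measurable borel"
    (is "?f \<in> _")
proof -
  note [measurable] = powr_borel_tube[OF F S(1) q] cone_core_borel[of e c]
  have snd: "snd \<in> borel_measurable (borel :: ((real ^ 'n) \<times> (real ^ 'n)) measure)"
    by (intro borel_measurable_continuous_onI continuous_intros)
  note [measurable] = measurable_compose[OF snd w]
  have "(indicator (cone_core e c) :: _ \<Rightarrow> ennreal) \<in> borel_measurable borel" by measurable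
  note [measurable] = measurable_compose[OF snd this]
  have "?f = (\<lambda>p. (ennreal (cmod (F (complex_vec (fst p) (snd p))) powr q) * indicator (UNIV \<times> S) p)
      * ennreal (w (snd p)) * indicator (cone_core e c) (snd p))"
    using S(2) by (auto simp: fun_eq_iff indicator_def ennreal_mult' cone_core_def)
  also have "\<dots> \<in> borel_measurable borel" by measurable
  finally show ?thesis .
qed

text \<open>
  The whole estimate for a function that is bounded and defined up to the real space.  The bound \<open>K\<close> does not
  enter the constant, so the result applies uniformly to upward shifts of a function in the Hardy space.
\<close>

lemma core_integral_le:
  fixes G :: "complex ^ 'n::finite \<Rightarrow> complex" and e :: 'n
  assumes G: "holomorphic_vec_on G (tube S)" and S: "open S" "0 \<in> S" "lorentz_cone e \<subseteq> S"
    and pq: "0 < p" "p < q" and c: "0 < c" "c \<le> 1" and N0: "0 \<le> N"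
    and N: "\<And>t. t \<in> S \<Longrightarrow> (\<integral>\<^sup>+x. ennreal (cmod (G (complex_vec x t)) powr p) \<partial>lborel) \<le> ennreal N"
    and bdd: "\<And>x y. y = 0 \<or> y \<in> lorentz_cone e \<Longrightarrow> cmod (G (complex_vec x y)) \<le> K"
  defines "n \<equiv> CARD('n)" and "\<kappa> \<equiv> q / p"
  defines "\<gamma> \<equiv> unit_ball_vol n / (unit_ball_vol (n + n) * c ^ n)"
  shows "(\<integral>\<^sup>+z. ennreal (cmod (G (complex_vec (fst z) (snd z))) powr q
            * lorentz_det e (snd z) powr (real n / 2 * (\<kappa> - 2)))
          * indicator (cone_core e c) (snd z) \<partial>lborel)
    \<le> ennreal (c powr - \<bar>real n / 2 * (\<kappa> - 2)\<bar> * (unit_ball_vol n * (1 / (\<kappa> - 1) + 1))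
        * \<gamma> powr (\<kappa> - 1) * (\<gamma> * unit_ball_vol n * 6 ^ n)\<^sup>2 * (8 * 5 ^ n) * N powr \<kappa>)"
    (is "_ \<le> ennreal (?c3 * ?c4 * _ * _ * _ * _)")
proof -
  have DIM: "DIM(real ^ 'n) = n" "DIM((real ^ 'n) \<times> (real ^ 'n)) = n + n"
    by (simp_all add: n_def)
  let ?\<omega> = "unit_ball_vol n" and ?\<omega>2 = "unit_ball_vol (n + n)"
  have pos: "0 < ?\<omega>" "0 < ?\<omega>2" by simp_all
  have \<gamma>: "0 < \<gamma>" using pos c by (simp add: \<gamma>_def)
  have \<kappa>: "1 < \<kappa>" using pq by (simp add: \<kappa>_def)
  define D where "D = \<gamma> * ?\<omega> * 6 ^ n"
  have D: "0 < D" using \<gamma> pos by (simp add: D_def)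
  define A where "A = \<gamma> * N"
  have A: "0 \<le> A" using \<gamma> N0 by (simp add: A_def)
  define f where "f u = ennreal (cmod (G (complex_vec u 0)) powr (p / 2))" for u
  have f [measurable]: "f \<in> borel_measurable borel"
    unfolding f_def using pq by (intro powr_borel_level[OF G S(2)]) simp
  let ?C = "cone_core e c"
  have core: "0 < norm y" "0 < c * norm y" "c * norm y \<le> norm y" "ball y (c * norm y) \<subseteq> lorentz_cone e"
    if "y \<in> ?C" for y
  proof -
    have "y \<noteq> 0" using that zero_notin_lorentz_cone[of e] by (auto simp: cone_core_def)
    then show "0 < norm y" "0 < c * norm y" "c * norm y \<le> norm y"
      using c by (auto intro: mult_left_le_one_le)
    show "ball y (c * norm y) \<subseteq> lorentz_cone e" using that by (simp add: cone_core_def)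
  qed
  have vol: "emeasure lborel (ball (x :: real ^ 'n) r) = ennreal (?\<omega> * r ^ n)"
      "emeasure lborel (ball (z :: (real ^ 'n) \<times> (real ^ 'n)) r) = ennreal (?\<omega>2 * r ^ (n + n))" if "0 < r" for x z r
    using that by (simp_all add: emeasure_ball n_def)
  \<comment> \<open>decay of \<open>G\<close> in the height\<close>
  have decay: "cmod (G (complex_vec x y)) powr p \<le> A / norm y ^ n" if y: "y \<in> ?C" for x y
  proof -
    let ?\<rho> = "c * norm y" and ?a = "cmod (G (complex_vec x y)) powr p"
    have "ennreal ?a * emeasure lborel (ball (x, y) ?\<rho>) \<le> emeasure lborel (ball y ?\<rho>) * ennreal N"
      using core(4)[OF y] S(3) by (intro pointwise_bound[OF G S(1) _ pq(1) N]) auto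
    then have "ennreal (?a * (?\<omega>2 * ?\<rho> ^ (n + n))) \<le> ennreal (?\<omega> * ?\<rho> ^ n * N)"
      using core(2)[OF y] pos N0 by (simp only: vol ennreal_mult'' ennreal_mult' mult_nonneg_nonneg
          powr_ge_zero zero_le_power less_imp_le)
    then have "?a * (?\<omega>2 * ?\<rho> ^ (n + n)) \<le> ?\<omega> * ?\<rho> ^ n * N"
      using core(2)[OF y] pos N0 by (subst (asm) ennreal_le_iff) auto
    then have "(?a * (?\<omega>2 * ?\<rho> ^ n)) * ?\<rho> ^ n \<le> (?\<omega> * N) * ?\<rho> ^ n"
      by (simp only: power_add mult_ac)
    then have "?a * (?\<omega>2 * ?\<rho> ^ n) \<le> ?\<omega> * N"
      using core(2)[OF y] by (subst (asm) mult_le_cancel_right_pos) auto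
    then show ?thesis
      using core(1)[OF y] c pos by (simp add: A_def \<gamma>_def power_mult_distrib field_simps)
  qed
  \<comment> \<open>domination by the maximal function of the boundary values\<close>
  have max: "ennreal (cmod (G (complex_vec x y)) powr (p / 2)) \<le> ennreal D * maximal_function f x" if y: "y \<in> ?C" for x y
  proof -
    let ?\<rho> = "c * norm y" and ?a = "ennreal (cmod (G (complex_vec x y)) powr (p / 2))"
    have "?a * emeasure lborel (ball (x, y) ?\<rho>)
        \<le> emeasure lborel (ball (0 :: real ^ 'n) ?\<rho>) * (emeasure lborel (ball (0 :: real ^ 'n) (6 * norm y)) * maximal_function f x)"
      unfolding f_def[abs_def]
    proof (rule power_le_maximal[OF G S(1,2) _ _ core(2,3)[OF y], where K = K])
      show "0 < p / 2" using pq by simp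
      show "ball y ?\<rho> \<subseteq> S" using core(4)[OF y] S(3) by simp
      fix v b x assume v: "v \<in> ball y ?\<rho>" and b: "0 \<le> (b :: real)"
      have *: "b *\<^sub>R v = 0 \<or> b *\<^sub>R v \<in> lorentz_cone e"
        using core(4)[OF y] v b lorentz_cone_scale[of v e b] by (cases "b = 0") auto
      show "b *\<^sub>R v \<in> S" using * S(2,3) by auto
      show "cmod (G (complex_vec x (b *\<^sub>R v))) \<le> K" by (rule bdd[OF *])
    qed
    also have "\<dots> = ennreal (?\<omega> * ?\<rho> ^ n * (?\<omega> * (6 * norm y) ^ n)) * maximal_function f x"
      using core(1,2)[OF y] pos by (subst ennreal_mult) (simp_all add: vol mult.assoc)
    also have "?\<omega> * ?\<rho> ^ n * (?\<omega> * (6 * norm y) ^ n) = D * (?\<omega>2 * ?\<rho> ^ (n + n))"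
    proof -
      have "\<gamma> * (?\<omega>2 * c ^ n) = ?\<omega>"
        using mult_pos_pos[OF pos(2) zero_less_power[OF c(1), of n]]
        unfolding \<gamma>_def by (metis less_irrefl nonzero_eq_divide_eq)
      then have "?\<omega> * ?\<rho> ^ n * (?\<omega> * (6 * norm y) ^ n) = \<gamma> * (?\<omega>2 * c ^ n) * ?\<rho> ^ n * (?\<omega> * (6 * norm y) ^ n)"
        by (simp only:)
      also have "\<dots> = D * (?\<omega>2 * ?\<rho> ^ (n + n))"
        unfolding D_def power_add power_mult_distrib by (simp only: mult_ac)
      finally show ?thesis .
    qed
    also have "ennreal (D * (?\<omega>2 * ?\<rho> ^ (n + n))) * maximal_function f x
        = (ennreal D * maximal_function f x) * emeasure lborel (ball (x, y) ?\<rho>)"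
      using core(1,2)[OF y] pos D by (simp add: vol ennreal_mult mult_ac)
    finally have "emeasure lborel (ball (x, y) ?\<rho>) * ?a \<le> emeasure lborel (ball (x, y) ?\<rho>) * (ennreal D * maximal_function f x)"
      by (simp only: mult.commute)
    then show ?thesis
      using ennreal_mult_le_mult_iff[of "emeasure lborel (ball (x, y) ?\<rho>)"]
        emeasure_ball_pos[OF core(2)[OF y], of "(x, y)"] emeasure_ball_finite[of "(x, y)" ?\<rho>]
      by (metis infinity_ennreal_def less_irrefl)
  qed
  let ?I = "\<lambda>x y. ennreal (cmod (G (complex_vec x y)) powr q * lorentz_det e y powr (real n / 2 * (\<kappa> - 2)))
      * indicator ?C y"
  have slice: "(\<integral>\<^sup>+y. ?I x y \<partial>lborel) \<le> ennreal (?c3 * ?c4 * A powr (\<kappa> - 1)) * (ennreal D * maximal_function f x)\<^sup>2" for x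
  proof -
    let ?H = "\<lambda>y. cmod (G (complex_vec x y)) powr p"
    have I_le: "?I x y \<le> ennreal ?c3 * (ennreal (?H y powr \<kappa> * (norm y ^ n) powr (\<kappa> - 2)) * indicator ?C y)" for y
    proof (cases "y \<in> ?C")
      case True
      have "cmod (G (complex_vec x y)) powr q = ?H y powr \<kappa>"
        using pq by (simp add: \<kappa>_def powr_powr)
      moreover have "lorentz_det e y powr (real n / 2 * (\<kappa> - 2)) \<le> ?c3 * (norm y ^ n) powr (\<kappa> - 2)"
        unfolding n_def by (rule lorentz_det_powr_core[OF True c])
      ultimately have "cmod (G (complex_vec x y)) powr q * lorentz_det e y powr (real n / 2 * (\<kappa> - 2))
          \<le> ?H y powr \<kappa> * (?c3 * (norm y ^ n) powr (\<kappa> - 2))"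
        by (simp add: mult_left_mono)
      also have "\<dots> = ?c3 * (?H y powr \<kappa> * (norm y ^ n) powr (\<kappa> - 2))"
        by (simp only: mult_ac)
      finally show ?thesis using True by (simp add: ennreal_leI flip: ennreal_mult)
    qed simp
    have bound: "(\<integral>\<^sup>+y. ?I x y \<partial>lborel) \<le> ennreal (?c3 * ?c4 * A powr (\<kappa> - 1) * M)"
      if M: "0 \<le> M" "\<And>y. y \<in> ?C \<Longrightarrow> ?H y \<le> M" for M
    proof -
      have "(\<integral>\<^sup>+y. ?I x y \<partial>lborel)
          \<le> (\<integral>\<^sup>+y. ennreal ?c3 * (ennreal (?H y powr \<kappa> * (norm y ^ n) powr (\<kappa> - 2)) * indicator ?C y) \<partial>lborel)"
        by (intro nn_integral_mono I_le)
      also have "\<dots> = ennreal ?c3 * (\<integral>\<^sup>+y. ennreal (?H y powr \<kappa> * (norm y ^ n) powr (\<kappa> - 2)) * indicator ?C y \<partial>lborel)"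
      proof (rule nn_integral_cmult)
        have m: "(\<lambda>z. ennreal (cmod (G (complex_vec (fst z) (snd z))) powr q * (norm (snd z) ^ n) powr (\<kappa> - 2))
            * indicator ?C (snd z)) \<in> borel_measurable borel"
          using pq by (intro core_integrand_borel[OF G S(1,3)]) (simp_all, measurable)
        have "Pair x \<in> borel_measurable borel"
          by (intro borel_measurable_continuous_onI continuous_intros)
        from measurable_compose[OF this m] have "(\<lambda>y. ennreal (cmod (G (complex_vec x y)) powr q * (norm y ^ n) powr (\<kappa> - 2))
            * indicator ?C y) \<in> borel_measurable borel"
          by (simp only: fst_conv snd_conv)
        moreover have "cmod (G (complex_vec x y)) powr q = ?H y powr \<kappa>" for y
          using pq by (simp add: \<kappa>_def powr_powr)
        ultimately show "(\<lambda>y. ennreal (?H y powr \<kappa> * (norm y ^ n) powr (\<kappa> - 2)) * indicator ?C y) \<in> borel_measurable lborel"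
          by simp
      qed
      also have "\<dots> \<le> ennreal ?c3 * ennreal (?\<omega> * (1 / (\<kappa> - 1) + 1) * A powr (\<kappa> - 1) * M)"
        using radial_integral_le[OF \<kappa> M(1) A, of ?C ?H, unfolded DIM] M(2) decay zero_notin_lorentz_cone[of e]
        by (intro mult_left_mono) (auto simp: cone_core_def)
      also have "\<dots> = ennreal (?c3 * ?c4 * A powr (\<kappa> - 1) * M)"
        by (simp add: mult.assoc flip: ennreal_mult')
      finally show ?thesis .
    qed
    show ?thesis
    proof (cases "A = 0")
      case True
      then have "?H y \<le> 0" if "y \<in> ?C" for y using decay[OF that, of x] by simp
      from bound[OF order.refl this] show ?thesis by (simp add: order.trans[OF _ zero_le])
    next
      case False
      have c34: "0 < ?c3 * ?c4 * A powr (\<kappa> - 1)"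
        using False A \<kappa> c pos by (intro mult_pos_pos add_pos_pos) auto
      show ?thesis
      proof (cases "maximal_function f x")
        case (real m)
        have "?H y \<le> (D * m)\<^sup>2" if "y \<in> ?C" for y
        proof -
          have "cmod (G (complex_vec x y)) powr (p / 2) \<le> D * m"
            using max[OF that, of x] real D by (simp flip: ennreal_mult)
          then have "(cmod (G (complex_vec x y)) powr (p / 2))\<^sup>2 \<le> (D * m)\<^sup>2"
            by (intro power_mono) auto
          then show ?thesis by (simp add: power2_eq_square flip: powr_add)
        qed
        from bound[OF zero_le_power2 this] show ?thesis
          using real D c34 by (simp add: ennreal_mult ennreal_power power_mult_distrib less_imp_le)
      next
        case top
        have "ennreal a * (ennreal D * top)\<^sup>2 = top" if "0 < a" for a
          using that D by (simp add: ennreal_mult_top power2_eq_square)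
        from this[OF c34] show ?thesis by (simp only: top top_greatest)
      qed
    qed
  qed
  have "(\<integral>\<^sup>+z. ennreal (cmod (G (complex_vec (fst z) (snd z))) powr q
            * lorentz_det e (snd z) powr (real n / 2 * (\<kappa> - 2)))
          * indicator ?C (snd z) \<partial>lborel)
      = (\<integral>\<^sup>+z. ?I (fst z) (snd z) \<partial>(lborel \<Otimes>\<^sub>M lborel))"
    by (simp only: lborel_prod)
  also have "\<dots> = (\<integral>\<^sup>+x. \<integral>\<^sup>+y. ?I x y \<partial>lborel \<partial>lborel)"
  proof -
    have "(\<lambda>z. ?I (fst z) (snd z)) \<in> borel_measurable borel"
      using pq by (intro core_integrand_borel[OF G S(1,3)]) (simp_all, measurable)
    then have "(\<lambda>z. ?I (fst z) (snd z)) \<in> borel_measurable (lborel \<Otimes>\<^sub>M lborel)"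
      by (simp add: lborel_prod)
    from lborel.nn_integral_fst[OF this] show ?thesis by simp
  qed
  also have "\<dots> \<le> (\<integral>\<^sup>+x. ennreal (?c3 * ?c4 * A powr (\<kappa> - 1)) * (ennreal D * maximal_function f x)\<^sup>2 \<partial>lborel)"
    by (intro nn_integral_mono slice)
  also have "\<dots> = ennreal (?c3 * ?c4 * A powr (\<kappa> - 1)) * ((ennreal D)\<^sup>2 * (\<integral>\<^sup>+x. (maximal_function f x)\<^sup>2 \<partial>lborel))"
    using maximal_function_measurable[OF f] by (simp add: power_mult_distrib nn_integral_cmult)
  also have "\<dots> \<le> ennreal (?c3 * ?c4 * A powr (\<kappa> - 1)) * ((ennreal D)\<^sup>2 * (ennreal (8 * 5 ^ n) * ennreal N))"
  proof (intro mult_left_mono)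
    have "(\<integral>\<^sup>+x. (maximal_function f x)\<^sup>2 \<partial>lborel) \<le> ennreal (8 * 5 ^ n) * (\<integral>\<^sup>+x. (f x)\<^sup>2 \<partial>lborel)"
      using maximal_function_L2[OF f] unfolding DIM .
    also have "(\<lambda>x. (f x)\<^sup>2) = (\<lambda>x. ennreal (cmod (G (complex_vec x 0)) powr p))"
      by (auto simp: f_def ennreal_power power2_eq_square simp flip: powr_add ennreal_mult)
    also have "ennreal (8 * 5 ^ n) * (\<integral>\<^sup>+x. ennreal (cmod (G (complex_vec x 0)) powr p) \<partial>lborel) \<le> ennreal (8 * 5 ^ n) * ennreal N"
      by (intro mult_left_mono N S(2)) simp
    finally show "(\<integral>\<^sup>+x. (maximal_function f x)\<^sup>2 \<partial>lborel) \<le> ennreal (8 * 5 ^ n) * ennreal N" .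
  qed simp_all
  also have "\<dots> = ennreal (?c3 * ?c4 * A powr (\<kappa> - 1) * (D\<^sup>2 * (8 * 5 ^ n * N)))"
    using N0 D \<kappa> c by (simp add: ennreal_mult ennreal_power)
  also have "?c3 * ?c4 * A powr (\<kappa> - 1) * (D\<^sup>2 * (8 * 5 ^ n * N))
      = ?c3 * ?c4 * \<gamma> powr (\<kappa> - 1) * D\<^sup>2 * (8 * 5 ^ n) * N powr \<kappa>"
  proof -
    have "N powr \<kappa> = N powr (\<kappa> - 1) * N"
      using N0 by (cases "N = 0") (simp_all add: powr_diff)
    moreover have "A powr (\<kappa> - 1) = \<gamma> powr (\<kappa> - 1) * N powr (\<kappa> - 1)"
      using \<gamma> N0 by (simp add: A_def powr_mult)
    ultimately show ?thesis by (simp only: mult_ac)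
  qed
  finally show ?thesis by (simp only: D_def)
qed


lemma complex_vec_add: "complex_vec x y + complex_vec 0 v = complex_vec x (y + v)"
  by (simp add: complex_vec_def vec_eq_iff complex_eq_iff)

lemma holomorphic_vec_on_shift:
  assumes F: "holomorphic_vec_on F (tube S)"
  shows "holomorphic_vec_on (\<lambda>z. F (z + complex_vec 0 v)) (tube {y. y + v \<in> S})"
  unfolding holomorphic_vec_on_def
proof
  fix z assume z: "z \<in> tube {y. y + v \<in> S}"
  let ?h = "\<lambda>z. z + complex_vec 0 v"
  have sub: "?h ` tube {y. y + v \<in> S} \<subseteq> tube S"
  proof safe
    fix z assume "z \<in> tube {y. y + v \<in> S}"
    then obtain x y where "z = complex_vec x y" "y + v \<in> S"
      unfolding tube_def by blast
    then show "?h z \<in> tube S" by (simp add: complex_vec_add)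
  qed
  then obtain L where L: "(F has_derivative L) (at (?h z) within tube S)" "\<And>c v. L (c *s v) = c * L v"
    using F z unfolding holomorphic_vec_on_def by blast
  have "(?h has_derivative (\<lambda>w. w)) (at z within tube {y. y + v \<in> S})"
    by (auto intro!: derivative_eq_intros)
  from diff_chain_within[OF this has_derivative_subset[OF L(1) sub]]
  have "((\<lambda>z. F (?h z)) has_derivative L) (at z within tube {y. y + v \<in> S})"
    by (simp add: o_def)
  with L(2) show "\<exists>L. ((\<lambda>z. F (?h z)) has_derivative L) (at z within tube {y. y + v \<in> S}) \<and> (\<forall>c v. L (c *s v) = c * L v)"
    by blast
qed

text \<open>
  Above the level \<open>v\<close> the balls of a fixed radius stay inside the cone, so the mean value inequality bounds
  the function uniformly.
\<close>

lemma hardy_bounded_above_level: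
  fixes F :: "complex ^ 'n::finite \<Rightarrow> complex"
  assumes F: "holomorphic_vec_on F (tube (lorentz_cone e))" and p: "0 < p" and v: "v \<in> lorentz_cone e"
    and N: "\<And>t. t \<in> lorentz_cone e \<Longrightarrow> (\<integral>\<^sup>+x. ennreal (cmod (F (complex_vec x t)) powr p) \<partial>lborel) \<le> ennreal N"
  obtains K where "\<And>x y. y = 0 \<or> y \<in> lorentz_cone e \<Longrightarrow> cmod (F (complex_vec x (y + v))) \<le> K"
proof -
  obtain \<delta> where \<delta>: "0 < \<delta>" "ball v \<delta> \<subseteq> lorentz_cone e"
    using open_lorentz_cone[of e] v unfolding open_contains_ball by blast
  let ?V = "\<lambda>z :: (real ^ 'n) \<times> (real ^ 'n). emeasure lborel (ball z \<delta>)"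
  define L where "L = emeasure lborel (ball (0 :: real ^ 'n) \<delta>) * ennreal N / ?V 0"
  have V: "0 < ?V 0" "?V 0 < \<infinity>"
    by (rule emeasure_ball_pos[OF \<delta>(1)], rule emeasure_ball_finite)
  have L: "L < \<infinity>"
    unfolding L_def using V emeasure_ball_finite[of "0 :: real ^ 'n" \<delta>]
    by (simp add: ennreal_divide_eq_top_iff ennreal_mult_eq_top_iff less_top[symmetric] zero_less_iff_neq_zero)
  have "cmod (F (complex_vec x (y + v))) \<le> enn2real L powr (1 / p)" if y: "y = 0 \<or> y \<in> lorentz_cone e" for x y
  proof -
    let ?a = "cmod (F (complex_vec x (y + v)))"
    have sub: "ball (y + v) \<delta> \<subseteq> lorentz_cone e"
    proof
      fix w assume "w \<in> ball (y + v) \<delta>"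
      then have "w - y \<in> ball v \<delta>" by (simp add: dist_norm algebra_simps)
      then have "w - y \<in> lorentz_cone e" using \<delta>(2) by blast
      then show "w \<in> lorentz_cone e"
        using y lorentz_cone_add[of "w - y" e y 1] by auto
    qed
    have "ennreal (?a powr p) * ?V (x, y + v) \<le> emeasure lborel (ball (y + v) \<delta>) * ennreal N"
      by (rule pointwise_bound[OF F open_lorentz_cone sub p N])
    then have "ennreal (?a powr p) * ?V 0 \<le> emeasure lborel (ball (0 :: real ^ 'n) \<delta>) * ennreal N"
      by (simp only: emeasure_lborel_ball_center[of "(x, y + v)"] emeasure_lborel_ball_center[of "y + v"])
    then have "ennreal (?a powr p) * ?V 0 / ?V 0 \<le> L"
      unfolding L_def by (rule divide_right_mono_ennreal)
    moreover have "ennreal (?a powr p) * ?V 0 / ?V 0 = ennreal (?a powr p)"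
      using V by (intro ennreal_mult_divide_eq) auto
    ultimately have "?a powr p \<le> enn2real L"
      using L by (cases L) auto
    then have "(?a powr p) powr (1 / p) \<le> enn2real L powr (1 / p)"
      using p by (intro powr_mono2) auto
    then show ?thesis using p by (simp add: powr_powr)
  qed
  then show ?thesis by (rule that)
qed

theorem theorem1p9:
  fixes e :: "'n::finite" and p q :: real and B :: "(real ^ 'n) set"
  assumes "CARD('n) \<ge> 3" and "1 \<le> p" and "p < q"
    and "restricted_region e B"
  shows "\<exists>C>0. \<forall>F\<in>hardy_space e p.
    (\<integral>\<^sup>+(x, y). ennreal (cmod (F (complex_vec x y)) powr q
          * lorentz_det e y powr (real CARD('n) / 2 * (q / p - 2)))
        * indicator (tube B) (complex_vec x y) \<partial>lebesgue)
      \<le> ennreal (C * hardy_norm e p F powr q)"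
proof -
  have p: "0 < p" and q: "0 < q" using assms(2,3) by auto
  obtain c where c: "0 < c" "c \<le> 1" "B \<subseteq> cone_core e c"
    using restricted_region_subset_core[OF assms(4)] by blast
  let ?n = "CARD('n)" and ?\<kappa> = "q / p"
  define \<gamma> where "\<gamma> = unit_ball_vol ?n / (unit_ball_vol (?n + ?n) * c ^ ?n)"
  define C where "C = c powr - \<bar>real ?n / 2 * (?\<kappa> - 2)\<bar> * (unit_ball_vol ?n * (1 / (?\<kappa> - 1) + 1))
        * \<gamma> powr (?\<kappa> - 1) * (\<gamma> * unit_ball_vol ?n * 6 ^ ?n)\<^sup>2 * (8 * 5 ^ ?n)"
  have "0 < C"
  proof -
    have pos: "0 < unit_ball_vol ?n" "0 < unit_ball_vol (?n + ?n)" by simp_all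
    have "0 < \<gamma>"
      unfolding \<gamma>_def by (intro divide_pos_pos mult_pos_pos zero_less_power pos c(1))
    then show ?thesis
      unfolding C_def using p assms(3) c(1) \<open>0 < \<gamma>\<close>
      by (intro mult_pos_pos zero_less_power add_pos_pos pos) auto
  qed
  moreover have "(\<integral>\<^sup>+(x, y). ennreal (cmod (F (complex_vec x y)) powr q
          * lorentz_det e y powr (real ?n / 2 * (?\<kappa> - 2)))
        * indicator (tube B) (complex_vec x y) \<partial>lebesgue)
      \<le> ennreal (C * hardy_norm e p F powr q)" if F: "F \<in> hardy_space e p" for F
  proof -
    have hol: "holomorphic_vec_on F (tube (lorentz_cone e))" and fin: "hardy_sup e p F < \<infinity>"
      using F by (auto simp: hardy_space_def)
    define N where "N = enn2real (hardy_sup e p F)"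
    have N0: "0 \<le> N" by (simp add: N_def)
    have N: "(\<integral>\<^sup>+x. ennreal (cmod (F (complex_vec x t)) powr p) \<partial>lborel) \<le> ennreal N"
      if "t \<in> lorentz_cone e" for t
    proof -
      have "(\<integral>\<^sup>+x. ennreal (cmod (F (complex_vec x t)) powr p) \<partial>lborel) \<le> hardy_sup e p F"
        unfolding hardy_sup_def nn_integral_completion using that by (rule SUP_upper)
      then show ?thesis using fin by (simp add: N_def)
    qed
    let ?w = "\<lambda>y. lorentz_det e y powr (real ?n / 2 * (?\<kappa> - 2))"
    define a where "a k = inverse (real (Suc k)) *\<^sub>R (axis e 1 :: real ^ 'n)" for k
    have a: "a k \<in> lorentz_cone e" for k
      unfolding a_def by (rule axis_in_lorentz_cone) simp
    let ?\<Psi> = "\<lambda>v z. ennreal (cmod (F (complex_vec (fst z) (snd z + v))) powr q * ?w (snd z)) * indicator (cone_core e c) (snd z)"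
    have shifted: "?\<Psi> (a k) \<in> borel_measurable borel \<and> (\<integral>\<^sup>+z. ?\<Psi> (a k) z \<partial>lborel) \<le> ennreal (C * N powr ?\<kappa>)" for k
    proof -
      let ?G = "\<lambda>z. F (z + complex_vec 0 (a k))" and ?S = "{y. y + a k \<in> lorentz_cone e}"
      have G: "holomorphic_vec_on ?G (tube ?S)" by (rule holomorphic_vec_on_shift[OF hol])
      have S: "open ?S" "0 \<in> ?S" "lorentz_cone e \<subseteq> ?S"
      proof -
        have "open ((\<lambda>y. y + a k) -` lorentz_cone e)"
          by (intro open_vimage open_lorentz_cone continuous_intros)
        then show "open ?S" by (simp add: vimage_def)
        show "0 \<in> ?S" using a by simp
        show "lorentz_cone e \<subseteq> ?S" using lorentz_cone_add[OF _ a, of _ 1 k] by auto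
      qed
      obtain K where K: "\<And>x y. y = 0 \<or> y \<in> lorentz_cone e \<Longrightarrow> cmod (F (complex_vec x (y + a k))) \<le> K"
        using hardy_bounded_above_level[OF hol p a N] by blast
      have "(\<integral>\<^sup>+z. ennreal (cmod (?G (complex_vec (fst z) (snd z))) powr q * ?w (snd z))
          * indicator (cone_core e c) (snd z) \<partial>lborel) \<le> ennreal (C * N powr ?\<kappa>)"
        unfolding C_def \<gamma>_def
        by (rule core_integral_le[OF G S p assms(3) c(1,2) N0, where K = K])
           (use N K in \<open>auto simp: complex_vec_add\<close>)
      moreover have "(\<lambda>z. ennreal (cmod (?G (complex_vec (fst z) (snd z))) powr q * ?w (snd z))
          * indicator (cone_core e c) (snd z)) \<in> borel_measurable borel"
        by (rule core_integrand_borel[OF G S(1,3) q]) measurable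
      ultimately show ?thesis by (simp only: complex_vec_add simp_thms)
    qed
    have lim: "(\<lambda>k. ?\<Psi> (a k) z) \<longlonglongrightarrow> ?\<Psi> 0 z" for z
    proof (cases "snd z \<in> cone_core e c")
      case True
      then have y: "snd z \<in> lorentz_cone e" by (simp add: cone_core_def)
      have "a \<longlonglongrightarrow> 0 *\<^sub>R axis e 1"
        unfolding a_def by (intro tendsto_intros LIMSEQ_inverse_real_of_nat)
      then have "(\<lambda>k. (fst z, snd z + a k)) \<longlonglongrightarrow> (fst z, snd z + 0)"
        by (intro tendsto_intros) simp
      moreover have "isCont (\<lambda>p. F (complex_vec (fst p) (snd p))) (fst z, snd z + 0)"
      proof -
        have "open ((UNIV :: (real ^ 'n) set) \<times> lorentz_cone e)"
          by (intro open_Times open_UNIV open_lorentz_cone)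
        with holomorphic_vec_continuous_on[OF hol]
        have "\<forall>p\<in>UNIV \<times> lorentz_cone e. isCont (\<lambda>p. F (complex_vec (fst p) (snd p))) p"
          by (simp only: continuous_on_eq_continuous_at)
        then show ?thesis by (rule bspec) (use y in \<open>simp add: mem_Times_iff\<close>)
      qed
      ultimately have "(\<lambda>k. F (complex_vec (fst (fst z, snd z + a k)) (snd (fst z, snd z + a k))))
          \<longlonglongrightarrow> F (complex_vec (fst (fst z, snd z + 0)) (snd (fst z, snd z + 0)))"
        by (rule isCont_tendsto_compose[rotated])
      then have "(\<lambda>k. F (complex_vec (fst z) (snd z + a k))) \<longlonglongrightarrow> F (complex_vec (fst z) (snd z + 0))"
        by (simp only: fst_conv snd_conv)
      then have "(\<lambda>k. ennreal (cmod (F (complex_vec (fst z) (snd z + a k))) powr q * ?w (snd z)))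
          \<longlonglongrightarrow> ennreal (cmod (F (complex_vec (fst z) (snd z + 0))) powr q * ?w (snd z))"
        using q by (intro tendsto_ennrealI tendsto_mult tendsto_powr2 tendsto_norm tendsto_const) auto
      with True show ?thesis by simp
    qed simp
    have "(\<integral>\<^sup>+(x, y). ennreal (cmod (F (complex_vec x y)) powr q * ?w y)
        * indicator (tube B) (complex_vec x y) \<partial>lebesgue)
        = (\<integral>\<^sup>+(x, y). ennreal (cmod (F (complex_vec x y)) powr q * ?w y)
        * indicator (tube B) (complex_vec x y) \<partial>lborel)"
      by (rule nn_integral_completion)
    also have "\<dots> \<le> (\<integral>\<^sup>+z. ?\<Psi> 0 z \<partial>lborel)"
      using c(3) by (intro nn_integral_mono) (auto simp: indicator_def)
    also have "\<dots> = (\<integral>\<^sup>+z. liminf (\<lambda>k. ?\<Psi> (a k) z) \<partial>lborel)"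
      using lim_imp_Liminf[OF trivial_limit_sequentially lim] by simp
    also have "\<dots> \<le> liminf (\<lambda>k. \<integral>\<^sup>+z. ?\<Psi> (a k) z \<partial>lborel)"
      using shifted by (intro nn_integral_liminf) simp
    also have "\<dots> \<le> limsup (\<lambda>k. \<integral>\<^sup>+z. ?\<Psi> (a k) z \<partial>lborel)"
      by (intro Liminf_le_Limsup) simp
    also have "\<dots> \<le> ennreal (C * N powr ?\<kappa>)"
      using shifted by (intro Limsup_bounded) (auto intro: always_eventually)
    also have "N powr ?\<kappa> = hardy_norm e p F powr q"
      by (simp add: hardy_norm_def N_def powr_powr)
    finally show ?thesis .
  qed
  ultimately show ?thesis by blast
qed

end
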